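(* There is a polynomial-time algorithm that, given a graph $G=(V,E)$, outputs a vertex cover $W$ of $G$ with $\max_{v\in V}|W\cap N[v]|\leq (2-\frac{1}{k})\,k = 2k-1$, where $k$ is the minimum of $\max_{v\in V}|H\cap N[v]|$ over all vertex covers $H$ of $G$.
   Context: For a vertex $v$, $N[v]$ is the closed neighbourhood of $v$ (containing $v$ and all its neighbours). The Fair Vertex Cover (Fair-VC) problem asks for a vertex cover $H$ (a vertex set meeting every edge) minimizing the sparseness $\max_{v\in V}|H\cap N[v]|$; the theorem asserts a polynomial-time $(2-\frac1k)$-approximation, $k$ being the optimum sparseness. *)

theory Defs
  imports Complex_Main "HOL-Computational_Algebra.Polynomial"
begin

section \<open>Fair vertex cover\<close>

definition simple_graph :: "'a set \<Rightarrow> 'a set set \<Rightarrow> bool" where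
  "simple_graph V E \<longleftrightarrow> finite V \<and> (\<forall>e\<in>E. e \<subseteq> V \<and> card e = 2)"

definition closed_nbhd :: "'a set set \<Rightarrow> 'a \<Rightarrow> 'a set" where
  "closed_nbhd E v = insert v {u. {u, v} \<in> E}"

definition vertex_cover :: "'a set \<Rightarrow> 'a set set \<Rightarrow> 'a set \<Rightarrow> bool" where
  "vertex_cover V E H \<longleftrightarrow> H \<subseteq> V \<and> (\<forall>e\<in>E. e \<inter> H \<noteq> {})"

text \<open>
  For finite \<open>V\<close> the supremum below is a maximum; using it fixes the value \<open>0\<close> for \<open>V = {}\<close>.
\<close>
definition sparseness :: "'a set \<Rightarrow> 'a set set \<Rightarrow> 'a set \<Rightarrow> nat" where
  "sparseness V E H = (SUP v\<in>V. card (H \<inter> closed_nbhd E v))"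

definition opt_sparseness :: "'a set \<Rightarrow> 'a set set \<Rightarrow> nat" where
  "opt_sparseness V E = Min (sparseness V E ` {H. vertex_cover V E H})"

section \<open>Polynomial time\<close>

text \<open>
  The machine model is a random access machine, with programs written in structured form. A
  program uses finitely many registers and an unbounded memory that is addressed through
  registers; registers and memory cells hold natural numbers. Every instruction and every test
  costs one unit of time. As the arithmetic is limited to addition and truncated subtraction, a
  step can increase the bit length of the numbers present by at most one, so this unit-cost
  measure agrees with Turing machine time up to a polynomial. With a multiplication
  instruction this would fail.
\<close>

type_synonym reg = nat

type_synonym state = "(reg \<Rightarrow> nat) \<times> (nat \<Rightarrow> nat)"

datatype prog =
    Const reg nat
  | Add reg reg reg
  | Sub reg reg reg
  | Load reg reg
  | Store reg reg
  | Seq prog prog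
  | If_Pos reg prog prog
  | While_Pos reg prog

text \<open>
  \<open>exec c s t s'\<close>: started in state \<open>s\<close>, the program \<open>c\<close> halts after exactly \<open>t\<close> steps in
  state \<open>s'\<close>.
\<close>
inductive exec :: "prog \<Rightarrow> state \<Rightarrow> nat \<Rightarrow> state \<Rightarrow> bool" where
  Const: "exec (Const i c) (r, m) 1 (r(i := c), m)"
| Add: "exec (Add i j k) (r, m) 1 (r(i := r j + r k), m)"
| Sub: "exec (Sub i j k) (r, m) 1 (r(i := r j - r k), m)"
| Load: "exec (Load i a) (r, m) 1 (r(i := m (r a)), m)"
| Store: "exec (Store a i) (r, m) 1 (r, m(r a := r i))"
| Seq: "\<lbrakk>exec c s t s'; exec d s' t' s''\<rbrakk> \<Longrightarrow> exec (Seq c d) s (t + t') s''"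
| If_True: "\<lbrakk>fst s i > 0; exec c s t s'\<rbrakk> \<Longrightarrow> exec (If_Pos i c d) s (Suc t) s'"
| If_False: "\<lbrakk>fst s i = 0; exec d s t s'\<rbrakk> \<Longrightarrow> exec (If_Pos i c d) s (Suc t) s'"
| While_False: "fst s i = 0 \<Longrightarrow> exec (While_Pos i c) s 1 s"
| While_True: "\<lbrakk>fst s i > 0; exec c s t s'; exec (While_Pos i c) s' t' s''\<rbrakk>
    \<Longrightarrow> exec (While_Pos i c) s (Suc (t + t')) s''"

lemma exec_deterministic:
  assumes "exec c s t s'" and "exec c s u z"
  shows "u = t \<and> z = s'"
  using assms
proof (induction arbitrary: u z rule: exec.induct)
  case (Const i c r m)
  then show ?case by cases simp
next
  case (Add i j k r m)
  then show ?case by cases simp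
next
  case (Sub i j k r m)
  then show ?case by cases simp
next
  case (Load i a r m)
  then show ?case by cases simp
next
  case (Store a i r m)
  then show ?case by cases simp
next
  case (Seq c s t s' d t' s'')
  from Seq.prems obtain v x w where "exec c s v x" "exec d x w z" "u = v + w"
    by cases simp
  then show ?case using Seq.IH by metis
next
  case (If_True s i c t s' d)
  from If_True.prems If_True.hyps(1) obtain v where "exec c s v z" "u = Suc v"
    by cases simp_all
  then show ?case using If_True.IH by metis
next
  case (If_False s i d t s' c)
  from If_False.prems If_False.hyps(1) obtain v where "exec d s v z" "u = Suc v"
    by cases simp_all
  then show ?case using If_False.IH by metis
next
  case (While_False s i c)
  from While_False.prems While_False.hyps show ?case by cases simp_all
next
  case (While_True s i c t s' t' s'')
  from While_True.prems While_True.hyps(1) obtain v x w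
    where "exec c s v x" "exec (While_Pos i c) x w z" "u = Suc (v + w)"
    by cases simp_all
  then show ?case using While_True.IH by metis
qed

text \<open>
  A bit string is placed in the first memory cells and its length in register \<open>0\<close>, both for
  the input and for the output. Reading off the output is charged as well: register \<open>0\<close> can be
  made exponentially large by repeated doubling.
\<close>
definition input_state :: "bool list \<Rightarrow> state" where
  "input_state x = ((\<lambda>i. if i = 0 then length x else 0),
                    (\<lambda>a. if a < length x \<and> x ! a then 1 else 0))"

definition output_bits :: "state \<Rightarrow> bool list" where
  "output_bits s = map (\<lambda>a. snd s a > 0) [0..<fst s 0]"

definition polynomial_time :: "(bool list \<Rightarrow> bool list) \<Rightarrow> bool" where
  "polynomial_time f \<longleftrightarrow>
     (\<exists>(p :: prog) (q :: nat poly). \<forall>x. \<exists>t s.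
        exec p (input_state x) t s \<and> t + length (f x) \<le> poly q (length x) \<and> output_bits s = f x)"

text \<open>
  A graph with vertices \<open>0, \<dots>, n - 1\<close> is presented by its adjacency matrix, row by row, and a
  set of vertices by its characteristic vector.
\<close>
definition encode_graph :: "nat \<Rightarrow> nat set set \<Rightarrow> bool list" where
  "encode_graph n E = map (\<lambda>a. {a div n, a mod n} \<in> E) [0..<n * n]"

definition encode_set :: "nat \<Rightarrow> nat set \<Rightarrow> bool list" where
  "encode_set n W = map (\<lambda>v. v \<in> W) [0..<n]"

end

theory Submission
  imports Defs
begin

text \<open>
  Let \<open>H\<close> be a vertex cover of sparseness at most \<open>k\<close>. A vertex outside \<open>H\<close> has all its neighbours
  in \<open>H\<close>, so every vertex of degree larger than \<open>k\<close> (a big vertex) is in \<open>H\<close> and has at most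
  \<open>k - 1\<close> neighbours there. Suppose that numbers \<open>X\<close> of scale \<open>N\<close> approximately satisfy the
  corresponding linear system: \<open>X u + X v \<ge> N\<close> on edges, \<open>X v \<ge> N / 2\<close> for big \<open>v\<close>, and a sum of at most
  \<open>(k - 1) N\<close> over the neighbours of a big vertex. Rounding at \<open>N / 2\<close> gives a cover in which a
  big vertex has at most \<open>2 (k - 1)\<close> neighbours, the error being absorbed by integrality. After
  shrinking to a minimal cover, a vertex that is not big sees at most \<open>k\<close> elements of the cover:
  it is outside the cover, or one of its neighbours is.

  No linear programming is needed to find \<open>X\<close>. Start with \<open>X = 0\<close> and, while some constraint is
  violated noticeably, move all its variables by one in the right direction, as in the
  perceptron algorithm. Truncated subtraction only helps. Each update decreases the squared
  distance of \<open>X\<close> from \<open>N\<close> times the indicator function of \<open>H\<close>, for every \<open>H\<close> as above at once, so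
  after more than \<open>n N\<^sup>2\<close> sweeps with an update there is no such \<open>H\<close> and \<open>k\<close> can be increased. With
  \<open>N = 8 n + 2\<close> all of this is polynomial.
\<close>

section \<open>The relaxation\<close>

text \<open>This is the rounding threshold. The factor 4 is chosen for
  \<open>big_vertex_bound\<close>, where \<open>half n\<close> must be at least
  \<open>2 * (k - 1) + n\<close> for \<open>k < n\<close>.\<close>

definition half :: "nat \<Rightarrow> nat" where
  "half n = 4 * n"

definition full :: "nat \<Rightarrow> nat" where
  "full n = 2 * half n + 2"

definition nbrs :: "nat \<Rightarrow> (nat \<Rightarrow> nat \<Rightarrow> bool) \<Rightarrow> nat \<Rightarrow> nat set" where
  "nbrs n A v = {u. u < n \<and> A v u}"

text \<open>
  \<open>H\<close> is a cover of sparseness at most \<open>k\<close>, stated only as far as the vertices of degree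
  larger than \<open>k\<close> are concerned. For the other vertices there is nothing to enforce.
\<close>
definition feasible :: "nat \<Rightarrow> (nat \<Rightarrow> nat \<Rightarrow> bool) \<Rightarrow> nat \<Rightarrow> nat set \<Rightarrow> bool" where
  "feasible n A k H \<longleftrightarrow>
     (\<forall>v<n. \<forall>u<n. A v u \<longrightarrow> u \<in> H \<or> v \<in> H) \<and>
     (\<forall>v<n. k < card (nbrs n A v) \<longrightarrow> v \<in> H \<and> card (H \<inter> nbrs n A v) \<le> k - 1)"

text \<open>The three constraints at scale \<open>full n\<close>, relaxed by 2, by 1 and by less
  than \<open>n\<close>. The slack pays for the quadratic error of a unit step, so that every
  violation found gives a true decrease of the potential.\<close>

definition settled :: "nat \<Rightarrow> (nat \<Rightarrow> nat \<Rightarrow> bool) \<Rightarrow> nat \<Rightarrow> (nat \<Rightarrow> nat) \<Rightarrow> nat \<Rightarrow> bool" where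
  "settled n A k X v \<longleftrightarrow>
     (\<forall>u<n. A v u \<longrightarrow> 2 * half n \<le> X u + X v) \<and>
     (k < card (nbrs n A v) \<longrightarrow>
        half n \<le> X v \<and> sum X (nbrs n A v) < (k - 1) * full n + n)"

definition target :: "nat \<Rightarrow> nat set \<Rightarrow> nat \<Rightarrow> int" where
  "target n H u = (if u \<in> H then int (full n) else 0)"

definition potential :: "nat \<Rightarrow> nat set \<Rightarrow> (nat \<Rightarrow> nat) \<Rightarrow> int" where
  "potential n H X = (\<Sum>u<n. (int (X u) - target n H u)\<^sup>2)"

lemma finite_nbrs [simp]: "finite (nbrs n A v)"
  by (simp add: nbrs_def)

lemma nbrs_subset: "nbrs n A v \<subseteq> {..<n}"
  by (auto simp: nbrs_def)

lemma card_nbrs_le: "card (nbrs n A v) \<le> n"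
  using card_mono[OF _ nbrs_subset] by fastforce

section \<open>Bounds for the potential and its decrease under the three kinds of update\<close>

lemma potential_nonneg: "0 \<le> potential n H X"
  by (simp add: potential_def sum_nonneg)

text \<open>No vertex has more than \<open>n\<close> neighbours. This keeps the search for
  \<open>k\<close> from passing \<open>n + 1\<close> for arbitrary input matrices.\<close>

lemma feasible_UNIV: "feasible n A (Suc n) UNIV"
proof -
  have "\<not> Suc n < card (nbrs n A v)" for v
    using card_nbrs_le[of n A v] by linarith
  then show ?thesis by (simp add: feasible_def)
qed

lemma potential_le:
  assumes "\<forall>u<n. X u \<le> full n"
  shows "potential n H X \<le> int (n * full n * full n)"
proof -
  have "(int (X u) - target n H u)\<^sup>2 \<le> int (full n * full n)" if "u < n" for u
  proof -
    have "\<bar>int (X u) - target n H u\<bar> \<le> int (full n)"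
      using assms that by (auto simp: target_def)
    then have "\<bar>int (X u) - target n H u\<bar>\<^sup>2 \<le> (int (full n))\<^sup>2"
      by (intro power_mono) auto
    then show ?thesis by (simp add: power2_eq_square)
  qed
  then have "potential n H X \<le> (\<Sum>u<n. int (full n * full n))"
    unfolding potential_def by (intro sum_mono) auto
  then show ?thesis by (simp add: mult.assoc)
qed

lemma potential_Suc:
  assumes "u < n"
  shows "potential n H (X(u := Suc (X u)))
    = potential n H X + 2 * (int (X u) - target n H u) + 1"
proof -
  let ?f = "\<lambda>X w. (int (X w) - target n H w)\<^sup>2"
  have *: "potential n H Y = ?f Y u + (\<Sum>w\<in>{..<n} - {u}. ?f Y w)" for Y
    unfolding potential_def using assms by (intro sum.remove) auto
  have "(\<Sum>w\<in>{..<n} - {u}. ?f (X(u := Suc (X u))) w) = (\<Sum>w\<in>{..<n} - {u}. ?f X w)"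
    by (intro sum.cong) auto
  then show ?thesis unfolding *[of X] *[of "X(u := Suc (X u))"]
    by (simp add: power2_eq_square) (simp add: algebra_simps)
qed

text \<open>One end of the edge lies in \<open>H\<close>, so the two targets add up to at least
  \<open>full n\<close>, while the two entries add up to less than \<open>full n - 2\<close>. Moving
  both up approaches the target on balance.\<close>

lemma potential_edge_step:
  assumes "feasible n A k H" "u < n" "v < n" "A v u" "X u + X v < 2 * half n"
    and Y: "Y = X(u := Suc (X u))"
  shows "potential n H (Y(v := Suc (Y v))) + 1 \<le> potential n H X"
proof -
  have "u \<in> H \<or> v \<in> H" using assms by (auto simp: feasible_def)
  then have "2 * int (half n) + 2 \<le> target n H u + target n H v"
    by (auto simp: target_def full_def)
  \<comment> \<open>This covers \<open>u = v\<close> as well, which occurs when the input matrix has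
    a diagonal entry. The summand 2 in \<open>full\<close> leaves room for the extra 1.\<close>
  moreover have "int (Y v) \<le> int (X v) + 1" by (simp add: Y)
  moreover have "int (X u) + int (X v) < 2 * int (half n)" using assms(5) by linarith
  ultimately show ?thesis
    using potential_Suc[OF assms(3), of H Y] potential_Suc[OF assms(2), of H X]
    unfolding Y[symmetric] by (simp add: algebra_simps)
qed

lemma potential_big_step:
  assumes "feasible n A k H" "v < n" "k < card (nbrs n A v)" "X v < half n"
  shows "potential n H (X(v := Suc (X v))) + 1 \<le> potential n H X"
  using assms by (simp add: potential_Suc feasible_def target_def full_def)

lemma potential_nbrs_step:
  assumes "feasible n A k H" "v < n" "k < card (nbrs n A v)"
    and big: "(k - 1) * full n + n \<le> sum X (nbrs n A v)"
  shows "potential n H (\<lambda>u. if u < n \<and> A v u then X u - 1 else X u) + 1 \<le> potential n H X"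
proof -
  let ?t = "target n H" and ?B = "nbrs n A v"
  let ?Y = "\<lambda>u. if u < n \<and> A v u then X u - 1 else X u"
  have B: "?B \<subseteq> {..<n}" by (rule nbrs_subset)
  have "(int (?Y u) - ?t u)\<^sup>2
      \<le> (int (X u) - ?t u)\<^sup>2 + (if u \<in> ?B then 1 - 2 * (int (X u) - ?t u) else 0)" for u
  proof (cases "u \<in> ?B")
    case True
    then have Y: "?Y u = X u - 1" by (auto simp: nbrs_def)
    \<comment> \<open>If \<open>X u = 0\<close>, truncated subtraction leaves the entry as it is,
      and the bound still holds because the target is nonnegative.\<close>
    have "?t u \<ge> 0" by (simp add: target_def)
    with True show ?thesis unfolding Y
      by (cases "X u") (auto simp: power2_eq_square algebra_simps)
  qed (auto simp: nbrs_def)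
  then have "potential n H ?Y
      \<le> potential n H X + (\<Sum>u<n. if u \<in> ?B then 1 - 2 * (int (X u) - ?t u) else 0)"
    unfolding potential_def sum.distrib[symmetric] by (intro sum_mono)
  also have "(\<Sum>u<n. if u \<in> ?B then 1 - 2 * (int (X u) - ?t u) else 0)
      = (\<Sum>u\<in>?B. 1 - 2 * (int (X u) - ?t u))"
    using B by (simp add: sum.If_cases Int_absorb1)
  also have "\<dots> = int (card ?B) - 2 * int (sum X ?B) + 2 * sum ?t ?B"
    by (simp add: sum_subtractf right_diff_distrib flip: sum_distrib_left)
  also have "sum ?t ?B = int (full n) * int (card (H \<inter> ?B))"
    by (simp add: target_def sum.If_cases Int_commute)
  also have "\<dots> \<le> int ((k - 1) * full n)"
  proof -
    have "card (H \<inter> ?B) \<le> k - 1" using assms by (auto simp: feasible_def)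
    then have "full n * card (H \<inter> ?B) \<le> full n * (k - 1)" by (rule mult_le_mono2)
    then show ?thesis by (simp add: mult.commute flip: of_nat_mult)
  qed
  \<comment> \<open>The total change is at most \<open>card ?B - 2 * n\<close>, hence at most
    \<open>- n\<close>, and \<open>n\<close> is positive because of \<open>v < n\<close>.\<close>
  finally show ?thesis using big card_nbrs_le[of n A v] \<open>v < n\<close> by linarith
qed

section \<open>Sparseness of the rounded cover at big and at small vertices\<close>

text \<open>Each neighbour in \<open>W\<close> contributes at least \<open>half n\<close> to the sum
  over the neighbours. With \<open>2 * (k - 1) + 1\<close> of them the sum would exceed its bound,
  as \<open>half n\<close> outweighs the accumulated slack. The vertex itself adds one more.\<close>

lemma big_vertex_bound:
  assumes set: "settled n A k X v" and v: "v < n" and k: "k < card (nbrs n A v)" "k \<ge> 1"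
    and W: "W \<subseteq> {u. half n \<le> X u}"
  shows "card (W \<inter> insert v (nbrs n A v)) \<le> 2 * k - 1"
proof -
  let ?C = "W \<inter> nbrs n A v"
  have "half n * card ?C = (\<Sum>u\<in>?C. half n)" by simp
  also have "\<dots> \<le> sum X ?C" using W by (intro sum_mono) auto
  also have "\<dots> \<le> sum X (nbrs n A v)" by (intro sum_mono2) auto
  also have "\<dots> < (k - 1) * full n + n" using set k by (simp add: settled_def)
  finally have *: "half n * card ?C < (k - 1) * full n + n" .
  have "card ?C \<le> 2 * (k - 1)"
  proof (rule ccontr)
    assume "\<not> ?thesis"
    then have "half n * (2 * (k - 1) + 1) \<le> half n * card ?C" by (intro mult_le_mono2) simp
    with * have "half n * (2 * (k - 1) + 1) < (k - 1) * full n + n" by linarith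
    then have "half n < 2 * (k - 1) + n" by (simp add: full_def algebra_simps)
    moreover have "k < n" using k card_nbrs_le[of n A v] by linarith
    ultimately show False by (simp add: half_def)
  qed
  moreover have "card (W \<inter> insert v (nbrs n A v)) \<le> Suc (card ?C)"
  proof -
    have "W \<inter> insert v (nbrs n A v) \<subseteq> insert v ?C" by auto
    then have "card (W \<inter> insert v (nbrs n A v)) \<le> card (insert v ?C)" by (intro card_mono) auto
    also have "\<dots> \<le> Suc (card ?C)" by (rule card_insert_le_m1) simp_all
    finally show ?thesis .
  qed
  ultimately show ?thesis using k by linarith
qed

text \<open>The closed neighbourhood has at most \<open>k + 1\<close> elements, and one of them is
  missing from \<open>W\<close>: the vertex itself or, by minimality, a neighbour.\<close>

lemma small_vertex_bound:
  assumes v: "v < n" and k: "card (nbrs n A v) \<le> k" "k \<ge> 1"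
    and min: "v \<in> W \<Longrightarrow> \<exists>u<n. A v u \<and> u \<notin> W"
  shows "card (W \<inter> insert v (nbrs n A v)) \<le> k"
proof (cases "v \<in> W")
  case True
  then obtain u where u: "u \<in> nbrs n A v" "u \<notin> W" using min by (auto simp: nbrs_def)
  have "W \<inter> insert v (nbrs n A v) \<subseteq> insert v (nbrs n A v - {u})" using u by auto
  then have "card (W \<inter> insert v (nbrs n A v)) \<le> card (insert v (nbrs n A v - {u}))"
    by (intro card_mono) auto
  also have "\<dots> \<le> Suc (card (nbrs n A v - {u}))" by (rule card_insert_le_m1) simp_all
  also have "\<dots> = card (nbrs n A v)" using u by (intro card_Suc_Diff1) auto
  finally show ?thesis using k by simp
next
  case False
  then have "W \<inter> insert v (nbrs n A v) \<subseteq> nbrs n A v" by auto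
  then have "card (W \<inter> insert v (nbrs n A v)) \<le> card (nbrs n A v)" by (intro card_mono) auto
  then show ?thesis using k by linarith
qed

section \<open>Reasoning about programs\<close>

text \<open>A weakest precondition for total correctness. The postcondition sees the number of
  steps, so termination and running time are proved together with the result. Determinism turns the
  rules for single instructions into equivalences.\<close>

definition wp :: "prog \<Rightarrow> (nat \<Rightarrow> state \<Rightarrow> bool) \<Rightarrow> state \<Rightarrow> bool" where
  "wp c Q s \<longleftrightarrow> (\<exists>t s'. exec c s t s' \<and> Q t s')"

lemma wp_exec: "exec c s t s' \<Longrightarrow> wp c Q s \<longleftrightarrow> Q t s'"
  unfolding wp_def using exec_deterministic by blast

lemma wp_mono:
  assumes "wp c P s" "\<And>t r m. P t (r, m) \<Longrightarrow> Q t (r, m)"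
  shows "wp c Q s"
  using assms unfolding wp_def by fast

inductive_cases exec_SeqE: "exec (Seq c d) s t s'"
inductive_cases exec_IfE: "exec (If_Pos i c d) s t s'"

lemma wp_Const [simp]: "wp (Const i c) Q (r, m) \<longleftrightarrow> Q 1 (r(i := c), m)"
  by (rule wp_exec, rule exec.Const)

lemma wp_Add [simp]: "wp (Add i j k) Q (r, m) \<longleftrightarrow> Q 1 (r(i := r j + r k), m)"
  by (rule wp_exec, rule exec.Add)

lemma wp_Sub [simp]: "wp (Sub i j k) Q (r, m) \<longleftrightarrow> Q 1 (r(i := r j - r k), m)"
  by (rule wp_exec, rule exec.Sub)

lemma wp_Load [simp]: "wp (Load i a) Q (r, m) \<longleftrightarrow> Q 1 (r(i := m (r a)), m)"
  by (rule wp_exec, rule exec.Load)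

lemma wp_Store [simp]: "wp (Store a i) Q (r, m) \<longleftrightarrow> Q 1 (r, m(r a := r i))"
  by (rule wp_exec, rule exec.Store)

lemma wp_Seq [simp]: "wp (Seq c d) Q = wp c (\<lambda>t. wp d (\<lambda>t'. Q (t + t')))"
  unfolding wp_def
proof (intro ext iffI; elim exE conjE)
  fix s t s' assume "exec (Seq c d) s t s'" "Q t s'"
  then show "\<exists>t s'. exec c s t s' \<and> (\<exists>t' s''. exec d s' t' s'' \<and> Q (t + t') s'')"
    by (elim exec_SeqE) blast
next
  fix s t s' t' s'' assume "exec c s t s'" "exec d s' t' s''" "Q (t + t') s''"
  then show "\<exists>t s'. exec (Seq c d) s t s' \<and> Q t s'"
    by (meson exec.Seq)
qed

lemma wp_If [simp]: "wp (If_Pos i c d) Q s \<longleftrightarrow>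
    (fst s i > 0 \<longrightarrow> wp c (\<lambda>t. Q (Suc t)) s) \<and> (fst s i = 0 \<longrightarrow> wp d (\<lambda>t. Q (Suc t)) s)"
proof (cases "fst s i = 0")
  case True
  have "exec (If_Pos i c d) s t s' \<longleftrightarrow> (\<exists>t'. t = Suc t' \<and> exec d s t' s')" for t s'
    using True by (auto elim: exec_IfE intro: exec.If_False)
  with True show ?thesis unfolding wp_def by (simp del: split_paired_Ex) metis
next
  case False
  have "exec (If_Pos i c d) s t s' \<longleftrightarrow> (\<exists>t'. t = Suc t' \<and> exec c s t' s')" for t s'
    using False by (auto elim: exec_IfE intro: exec.If_True)
  with False show ?thesis unfolding wp_def by (simp del: split_paired_Ex) metis
qed

text \<open>There are at most \<open>\<mu> s\<close> rounds, each costing at most \<open>T\<close>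
  steps and one test; the final 1 is the test that fails.\<close>

lemma wp_While:
  assumes "Inv s"
    and body: "\<And>s. Inv s \<Longrightarrow> fst s i > 0 \<Longrightarrow>
      wp c (\<lambda>t s'. t \<le> T \<and> Inv s' \<and> \<mu> s' < \<mu> s) s"
    and post: "\<And>t s'. Inv s' \<Longrightarrow> fst s' i = 0 \<Longrightarrow> t \<le> \<mu> s * (T + 1) + 1 \<Longrightarrow> Q t s'"
  shows "wp (While_Pos i c) Q s"
proof -
  have "\<exists>t s'. exec (While_Pos i c) s t s' \<and> Inv s' \<and> fst s' i = 0 \<and> t \<le> \<mu> s * (T + 1) + 1"
    using \<open>Inv s\<close>
  proof (induction "\<mu> s" arbitrary: s rule: less_induct)
    case less
    show ?case
    proof (cases "fst s i = 0")
      case True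
      then show ?thesis using exec.While_False[OF True] less.prems by (intro exI[of _ 1] exI[of _ s]) auto
    next
      case False
      then obtain t s' where c: "exec c s t s'" "t \<le> T" "Inv s'" "\<mu> s' < \<mu> s"
        using body[OF less.prems] unfolding wp_def by blast
      then obtain t' s'' where w: "exec (While_Pos i c) s' t' s''" "Inv s''" "fst s'' i = 0"
          "t' \<le> \<mu> s' * (T + 1) + 1"
        using less.hyps[OF c(4,3)] by blast
      have "exec (While_Pos i c) s (Suc (t + t')) s''"
        using False c w by (intro exec.While_True) auto
      moreover have "Suc (t + t') \<le> \<mu> s * (T + 1) + 1"
      proof -
        have "(\<mu> s' + 1) * (T + 1) \<le> \<mu> s * (T + 1)" using c by (intro mult_le_mono1) simp
        then show ?thesis using c w by simp
      qed
      ultimately show ?thesis using w by blast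
    qed
  qed
  then obtain t s' where "exec (While_Pos i c) s t s'" "Inv s'" "fst s' i = 0"
      "t \<le> \<mu> s * (T + 1) + 1"
    by blast
  then show ?thesis using post[of s' t] unfolding wp_def by blast
qed

text \<open>Memory split at address \<open>b\<close>: below it the input matrix, later overwritten
  by the output, and from \<open>b\<close> on the array \<open>X\<close>. Writes to the array then
  become function updates of \<open>X\<close>.\<close>

definition mem :: "nat \<Rightarrow> (nat \<Rightarrow> nat) \<Rightarrow> (nat \<Rightarrow> nat) \<Rightarrow> nat \<Rightarrow> nat" where
  "mem b m X = (\<lambda>a. if a < b then m a else X (a - b))"

lemma mem_low [simp]: "a < b \<Longrightarrow> mem b m X a = m a"
  by (simp add: mem_def)

lemma mem_high [simp]: "mem b m X (b + u) = X u"
  by (simp add: mem_def)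

lemma mem_upd_high [simp]: "(mem b m X)(b + u := x) = mem b m (X(u := x))"
  by (auto simp: mem_def fun_eq_iff)

lemma mem_upd_low [simp]: "a < b \<Longrightarrow> (mem b m X)(a := x) = mem b (m(a := x)) X"
  by (auto simp: mem_def fun_eq_iff)

section \<open>The program\<close>

abbreviation then_do :: "prog \<Rightarrow> prog \<Rightarrow> prog" (infixr ";;" 60) where
  "c ;; d \<equiv> Seq c d"

text \<open>The empty branch of a conditional. Register 22 is scratch space for test values, so
  clearing it after its test does no harm.\<close>

abbreviation (input) skip :: prog where
  "skip \<equiv> Const 22 0"

text \<open>
  Register 2 holds the number \<open>n\<close> of vertices, register 3 the base address \<open>n * n\<close> of the array
  \<open>X\<close>, register 9 the current \<open>k\<close>, register 11 the number of sweeps left for it, and register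
  14 is set when a sweep changes \<open>X\<close>. The vertices \<open>v\<close> and \<open>u\<close> of the two nested loops are
  represented by the counters 12 and 16, which run down from \<open>n\<close>, and by the addresses 13 and
  17 of \<open>X v\<close> and \<open>X u\<close>; register 15 is the address of the matrix entry.
\<close>
definition edge_body :: prog where
  "edge_body =
     Load 20 15 ;;
     If_Pos 20
       (Add 18 18 4 ;; Load 20 17 ;; Add 19 19 20 ;; Load 21 13 ;; Add 22 20 21 ;; Sub 22 6 22 ;;
        If_Pos 22
          (Add 20 20 4 ;; Store 17 20 ;; Load 21 13 ;; Add 21 21 4 ;; Store 13 21 ;; Const 14 1)
          skip)
       skip ;;
     Add 15 15 4 ;; Add 17 17 4 ;; Sub 16 16 4"

text \<open>A second matrix pointer in register 23 rereads the row, while register 15 stays at the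
  start of the next row.\<close>

definition decr_body :: prog where
  "decr_body =
     Load 20 23 ;;
     If_Pos 20 (Load 20 17 ;; Sub 20 20 4 ;; Store 17 20) skip ;;
     Add 23 23 4 ;; Add 17 17 4 ;; Sub 16 16 4"

definition raise_step :: prog where
  "raise_step =
     Load 21 13 ;; Sub 22 5 21 ;;
     If_Pos 22 (Add 21 21 4 ;; Store 13 21 ;; Const 14 1) skip"

text \<open>Adding 1 before the truncated subtraction makes the test positive exactly when register
  19 is at least register 10. Subtracting \<open>n\<close> from register 15 returns to the start of
  the row.\<close>

definition decr_step :: prog where
  "decr_step =
     Add 22 19 4 ;; Sub 22 22 10 ;;
     If_Pos 22
       (Const 14 1 ;; Sub 23 15 2 ;; Const 17 0 ;; Add 17 17 3 ;; Const 16 0 ;; Add 16 16 2 ;;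
        While_Pos 16 decr_body)
       skip"

definition row_body :: prog where
  "row_body =
     Const 17 0 ;; Add 17 17 3 ;; Const 18 0 ;; Const 19 0 ;; Const 16 0 ;; Add 16 16 2 ;;
     While_Pos 16 edge_body ;;
     Sub 22 18 9 ;; If_Pos 22 (raise_step ;; decr_step) skip ;;
     Add 13 13 4 ;; Sub 12 12 4"

definition sweep :: prog where
  "sweep =
     Const 14 0 ;; Const 15 0 ;; Const 13 0 ;; Add 13 13 3 ;; Const 12 0 ;; Add 12 12 2 ;;
     While_Pos 12 row_body"

definition search_body :: prog where
  "search_body =
     sweep ;;
     If_Pos 14
       (Sub 11 11 4 ;;
        If_Pos 11 skip (Add 9 9 4 ;; Add 10 10 7 ;; Const 11 0 ;; Add 11 11 8))
       skip"

definition scan_body :: prog where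
  "scan_body =
     Load 20 15 ;;
     If_Pos 20 (Load 20 17 ;; Sub 22 5 20 ;; If_Pos 22 (Const 18 1) skip) skip ;;
     Add 15 15 4 ;; Add 17 17 4 ;; Sub 16 16 4"

definition shrink_body :: prog where
  "shrink_body =
     Const 17 0 ;; Add 17 17 3 ;; Const 18 0 ;; Const 16 0 ;; Add 16 16 2 ;;
     While_Pos 16 scan_body ;;
     If_Pos 18 skip (Const 20 0 ;; Store 13 20) ;;
     Add 13 13 4 ;; Sub 12 12 4"

definition shrink :: prog where
  "shrink =
     Const 15 0 ;; Const 13 0 ;; Add 13 13 3 ;; Const 12 0 ;; Add 12 12 2 ;;
     While_Pos 12 shrink_body"

text \<open>The cell written is \<open>X + 1 - half n\<close>, which is positive exactly when
  \<open>half n \<le> X\<close>; the output convention only asks for positivity.\<close>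

definition copy_body :: prog where
  "copy_body =
     Load 20 17 ;; Add 20 20 4 ;; Sub 20 20 5 ;; Store 13 20 ;;
     Add 13 13 4 ;; Add 17 17 4 ;; Sub 16 16 4"

definition copy_out :: prog where
  "copy_out =
     Const 13 0 ;; Const 17 0 ;; Add 17 17 3 ;; Const 16 0 ;; Add 16 16 2 ;;
     While_Pos 16 copy_body ;; Const 0 0 ;; Add 0 0 2"

definition root_body :: prog where
  "root_body = Add 3 3 2 ;; Add 3 3 2 ;; Add 3 3 4 ;; Add 2 2 4 ;; Sub 22 0 3"

definition add_body :: "reg \<Rightarrow> reg \<Rightarrow> prog" where
  "add_body i j = Add i i j ;; Sub 16 16 4"

definition init :: prog where
  "init =
     Add 5 2 2 ;; Add 5 5 5 ;; Add 6 5 5 ;; Add 7 6 4 ;; Add 7 7 4 ;;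
     Const 20 0 ;; Const 16 0 ;; Add 16 16 7 ;; While_Pos 16 (add_body 20 7) ;;
     Const 8 1 ;; Const 16 0 ;; Add 16 16 2 ;; While_Pos 16 (add_body 8 20) ;;
     Const 9 1 ;; Const 10 0 ;; Add 10 10 2 ;; Const 11 0 ;; Add 11 11 8 ;; Const 14 1"

definition fair_vc_prog :: prog where
  "fair_vc_prog =
     (Const 4 1 ;; Sub 22 0 3 ;; While_Pos 22 root_body) ;; init ;;
     While_Pos 14 search_body ;; shrink ;; copy_out"

text \<open>Register 8 exceeds the bound of \<open>potential_le\<close> by one and is the initial
  budget of sweeps for each \<open>k\<close>; register 10 is the bound on neighbour sums in
  \<open>settled\<close>.\<close>

definition env :: "nat \<Rightarrow> nat \<Rightarrow> (reg \<Rightarrow> nat) \<Rightarrow> bool" where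
  "env n k r \<longleftrightarrow> r 2 = n \<and> r 3 = n * n \<and> r 4 = 1 \<and> r 5 = half n \<and> r 6 = 2 * half n \<and>
     r 7 = full n \<and> r 8 = Suc (n * full n * full n) \<and> r 9 = k \<and> r 10 = (k - 1) * full n + n"

lemma env_upd [simp]: "10 < i \<Longrightarrow> env n k (r(i := x)) \<longleftrightarrow> env n k r"
  by (auto simp: env_def)

definition adj :: "nat \<Rightarrow> (nat \<Rightarrow> nat) \<Rightarrow> nat \<Rightarrow> nat \<Rightarrow> bool" where
  "adj n m v u \<longleftrightarrow> m (v * n + u) > 0"

lemma entry_less: "v < n \<Longrightarrow> u < n \<Longrightarrow> v * n + u < n * (n::nat)"
proof -
  assume "v < n" "u < n"
  then have "v * n + u < Suc v * n" by simp
  also have "\<dots> \<le> n * n" using \<open>v < n\<close> by (intro mult_le_mono1) simp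
  finally show ?thesis .
qed

lemma nbrs_0 [simp]: "nbrs 0 A v = {}"
  by (simp add: nbrs_def)

lemma nbrs_Suc: "nbrs (Suc j) A v = (if A v j then insert j (nbrs j A v) else nbrs j A v)"
  by (auto simp: nbrs_def less_Suc_eq)

lemma notin_nbrs [simp]: "j \<notin> nbrs j A v"
  by (simp add: nbrs_def)

text \<open>The argument \<open>g\<close> is the change flag in register 14. Quantifying over all
  feasible \<open>H\<close> lets the analysis use covers that the program never knows.\<close>

definition progress ::
    "nat \<Rightarrow> (nat \<Rightarrow> nat \<Rightarrow> bool) \<Rightarrow> nat \<Rightarrow> nat \<Rightarrow> (nat \<Rightarrow> nat) \<Rightarrow> (nat \<Rightarrow> nat) \<Rightarrow> bool" where
  "progress n A k g X0 X \<longleftrightarrow>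
     (\<forall>u<n. X u \<le> full n) \<and> (g = 0 \<longrightarrow> X = X0) \<and>
     (\<forall>H. feasible n A k H \<longrightarrow> potential n H X + (if g = 0 then 0 else 1) \<le> potential n H X0)"

lemma progress_refl: "\<forall>u<n. X u \<le> full n \<Longrightarrow> progress n A k 0 X X"
  by (simp add: progress_def)

lemma progress_step:
  assumes "progress n A k g X0 X" "\<forall>u<n. Y u \<le> full n"
    and "\<And>H. feasible n A k H \<Longrightarrow> potential n H Y + 1 \<le> potential n H X"
  shows "progress n A k (Suc 0) X0 Y"
  using assms unfolding progress_def by (fastforce split: if_splits)

section \<open>One sweep over all constraints\<close>

definition row_inv where
  "row_inv n m0 k c v r \<longleftrightarrow>
     env n k r \<and> r 11 = c \<and> r 12 = n - v \<and> r 13 = n * n + v"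

lemma row_inv_upd [simp]:
  "13 < i \<Longrightarrow> row_inv n m0 k c v (r(i := x)) \<longleftrightarrow> row_inv n m0 k c v r"
  by (auto simp: row_inv_def)

text \<open>
  The sum in register 19 is collected while \<open>X\<close> may still grow, so it is in general only a lower
  bound; that suffices for a sum found to be too large. It is exact if nothing has changed in
  this sweep, and that is the case in which it certifies a vertex as settled.
\<close>
definition edge_inv where
  "edge_inv n m0 k c v X0 X j r \<longleftrightarrow>
     row_inv n m0 k c v r \<and> v < n \<and> j \<le> n \<and> r 15 = v * n + j \<and> r 16 = n - j \<and> r 17 = n * n + j \<and>
     r 18 = card (nbrs j (adj n m0) v) \<and> r 19 \<le> sum X (nbrs j (adj n m0) v) \<and>
     progress n (adj n m0) k (r 14) X0 X \<and>
     (r 14 = 0 \<longrightarrow> (\<forall>w<v. settled n (adj n m0) k X0 w) \<and> r 19 = sum X0 (nbrs j (adj n m0) v) \<and>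
        (\<forall>u<j. adj n m0 v u \<longrightarrow> 2 * half n \<le> X0 u + X0 v))"

lemma edge_body:
  assumes inv: "edge_inv n m0 k c v X0 X j r" and j: "j < n"
  shows "wp edge_body (\<lambda>t s'. t \<le> 20 \<and>
    (\<exists>X j. edge_inv n m0 k c v X0 X j (fst s') \<and> snd s' = mem (n * n) m0 X) \<and>
    fst s' 16 < r 16) (r, mem (n * n) m0 X)"
proof -
  let ?A = "adj n m0"
  define d where "d = n - j"
  have reg: "r 4 = 1" "r 6 = 2 * half n" "r 13 = n * n + v" "r 15 = v * n + j" "r 16 = d"
      "r 17 = n * n + j" and v: "v < n" and d: "d > 0"
    using inv j by (auto simp: edge_inv_def row_inv_def env_def d_def)
  have entry: "mem (n * n) m0 X (v * n + j) = m0 (v * n + j)"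
    using entry_less[OF v j] by simp
  have low: "r 19 \<le> sum X (nbrs j ?A v)" and row: "row_inv n m0 k c v r"
    and card: "r 18 = card (nbrs j ?A v)" and pro: "progress n ?A k (r 14) X0 X"
    and quiet: "r 14 = 0 \<Longrightarrow> (\<forall>w<v. settled n ?A k X0 w) \<and> r 19 = sum X0 (nbrs j ?A v) \<and>
        (\<forall>u<j. ?A v u \<longrightarrow> 2 * half n \<le> X0 u + X0 v)"
    using inv by (auto simp: edge_inv_def)
  \<comment> \<open>Without an update, the check concerns the current \<open>X\<close>, which by
    \<open>progress\<close> is still \<open>X0\<close> as long as register 14 is 0.\<close>
  have keep: "edge_inv n m0 k c v X0 X (Suc j) r'"
    if "row_inv n m0 k c v r'" "r' 14 = r 14" "r' 15 = v * n + Suc j" "r' 16 = d - 1"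
      "r' 17 = n * n + Suc j" "r' 18 = r 18 + (if ?A v j then 1 else 0)"
      "r' 19 = r 19 + (if ?A v j then X j else 0)"
      "?A v j \<Longrightarrow> 2 * half n \<le> X j + X v" for r'
    unfolding edge_inv_def
    using that low card pro quiet j v by (auto simp: nbrs_Suc less_Suc_eq progress_def d_def)
  have upd: "edge_inv n m0 k c v X0 Z (Suc j) r'"
    if "row_inv n m0 k c v r'" "r' 14 = 1" "r' 15 = v * n + Suc j" "r' 16 = d - 1"
      "r' 17 = n * n + Suc j" "r' 18 = r 18 + 1" "r' 19 = r 19 + X j"
      and A: "?A v j" and viol: "X j + X v < 2 * half n"
      and Y: "Y = X(j := Suc (X j))" and Z: "Z = Y(v := Suc (Y v))" for r' Y Z
  proof -
    have le: "X u \<le> Z u" for u by (simp add: Y Z)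
    have "sum X (nbrs j ?A v) \<le> sum Z (nbrs j ?A v)" by (intro sum_mono le)
    then have "r' 19 \<le> sum Z (nbrs (Suc j) ?A v)"
      using that(7) low le[of j] A by (simp add: nbrs_Suc)
    moreover have "progress n ?A k (Suc 0) X0 Z"
    proof (rule progress_step[OF pro])
      \<comment> \<open>Both entries are below \<open>2 * half n\<close>, and none grows by more
        than 2, even if \<open>j = v\<close>.\<close>
      show "\<forall>u<n. Z u \<le> full n"
        using pro viol by (auto simp: Y Z progress_def full_def)
      show "potential n H Z + 1 \<le> potential n H X" if "feasible n ?A k H" for H
        unfolding Z using potential_edge_step[OF that j v A viol Y] .
    qed
    ultimately show ?thesis
      unfolding edge_inv_def using that(1-6) A card j v by (simp add: nbrs_Suc d_def)
  qed
  consider (none) "\<not> ?A v j" | (ok) "?A v j" "2 * half n \<le> X j + X v"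
    | (viol) "?A v j" "X j + X v < 2 * half n"
    by linarith
  then show ?thesis
  proof cases
    case none
    then show ?thesis
      using row d by (auto simp: edge_body_def reg entry adj_def intro!: exI keep)
  next
    case ok
    then show ?thesis
      using row d by (auto simp: edge_body_def reg entry adj_def intro!: exI keep)
  next
    case viol
    define Y where "Y = X(j := Suc (X j))"
    define Z where "Z = Y(v := Suc (Y v))"
    have mem: "(mem (n * n) m0 X)(n * n + j := Suc (X j)) = mem (n * n) m0 Y"
      by (simp add: Y_def)
    have "(mem (n * n) m0 Y)(n * n + v := Suc (Y v)) = mem (n * n) m0 Z"
      by (simp add: Z_def)
    with viol mem show ?thesis
      using row d
      by (auto simp: edge_body_def reg entry adj_def simp del: mem_upd_high
          intro!: exI upd[OF _ _ _ _ _ _ _ viol Y_def Z_def])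
  qed
qed

lemma edge_loop:
  assumes "edge_inv n m0 k c v X0 X 0 r"
  shows "wp (While_Pos 16 edge_body) (\<lambda>t s'. t \<le> 21 * n + 1 \<and>
    (\<exists>X. edge_inv n m0 k c v X0 X n (fst s') \<and> snd s' = mem (n * n) m0 X)) (r, mem (n * n) m0 X)"
proof (rule wp_While[where T = 20 and \<mu> = "\<lambda>s. fst s 16"
      and Inv = "\<lambda>s. \<exists>X j. edge_inv n m0 k c v X0 X j (fst s) \<and> snd s = mem (n * n) m0 X"])
  show "\<exists>X' j. edge_inv n m0 k c v X0 X' j (fst (r, mem (n * n) m0 X)) \<and>
      snd (r, mem (n * n) m0 X) = mem (n * n) m0 X'"
    using assms by auto
next
  fix s :: state
  assume "\<exists>X j. edge_inv n m0 k c v X0 X j (fst s) \<and> snd s = mem (n * n) m0 X" "0 < fst s 16"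
  then obtain X j where X: "edge_inv n m0 k c v X0 X j (fst s)" "snd s = mem (n * n) m0 X"
    by blast
  moreover have "j < n" using X(1) \<open>0 < fst s 16\<close> by (auto simp: edge_inv_def)
  ultimately show "wp edge_body (\<lambda>t s'. t \<le> 20 \<and>
      (\<exists>X j. edge_inv n m0 k c v X0 X j (fst s') \<and> snd s' = mem (n * n) m0 X) \<and>
      fst s' 16 < fst s 16) s"
    using edge_body[of n m0 k c v X0 X j "fst s"] by (cases s) simp
next
  fix t and s' :: state
  assume "\<exists>X j. edge_inv n m0 k c v X0 X j (fst s') \<and> snd s' = mem (n * n) m0 X"
    "fst s' 16 = 0" and t: "t \<le> fst (r, mem (n * n) m0 X) 16 * (20 + 1) + 1"
  then obtain X j where X: "edge_inv n m0 k c v X0 X j (fst s')" "snd s' = mem (n * n) m0 X"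
    by blast
  then have "j = n" using \<open>fst s' 16 = 0\<close> by (auto simp: edge_inv_def)
  moreover have "r 16 = n" using assms by (simp add: edge_inv_def)
  ultimately show "t \<le> 21 * n + 1 \<and>
      (\<exists>X. edge_inv n m0 k c v X0 X n (fst s') \<and> snd s' = mem (n * n) m0 X)"
    using X t by auto
qed

definition decr_inv where
  "decr_inv n m0 k c v j r \<longleftrightarrow>
     row_inv n m0 k c v r \<and> j \<le> n \<and> r 14 = 1 \<and> r 15 = v * n + n \<and> r 16 = n - j \<and>
     r 17 = n * n + j \<and> r 23 = v * n + j"

text \<open>The array after the first \<open>j\<close> entries of the row have been treated; for
  \<open>j = n\<close> it is the update in \<open>potential_nbrs_step\<close>.\<close>

definition decreased :: "(nat \<Rightarrow> nat \<Rightarrow> bool) \<Rightarrow> nat \<Rightarrow> (nat \<Rightarrow> nat) \<Rightarrow> nat \<Rightarrow> nat \<Rightarrow> nat" where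
  "decreased A v X j = (\<lambda>u. if u < j \<and> A v u then X u - 1 else X u)"

lemma decreased_0 [simp]: "decreased A v X 0 = X"
  by (simp add: decreased_def)

lemma decreased_Suc:
  "decreased A v X (Suc j) = (if A v j then (decreased A v X j)(j := X j - 1) else decreased A v X j)"
  by (auto simp: decreased_def fun_eq_iff less_Suc_eq)

lemma decreased_self [simp]: "decreased A v X j j = X j"
  by (simp add: decreased_def)

lemma decr_loop:
  assumes inv: "decr_inv n m0 k c v 0 r" and v: "v < n"
  shows "wp (While_Pos 16 decr_body) (\<lambda>t s'. t \<le> 11 * n + 1 \<and>
    decr_inv n m0 k c v n (fst s') \<and> snd s' = mem (n * n) m0 (decreased (adj n m0) v X n))
    (r, mem (n * n) m0 X)"
proof (rule wp_While[where T = 10 and \<mu> = "\<lambda>s. fst s 16" and Inv = "\<lambda>s. \<exists>j.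
      decr_inv n m0 k c v j (fst s) \<and> snd s = mem (n * n) m0 (decreased (adj n m0) v X j)"])
  show "\<exists>j. decr_inv n m0 k c v j (fst (r, mem (n * n) m0 X)) \<and>
      snd (r, mem (n * n) m0 X) = mem (n * n) m0 (decreased (adj n m0) v X j)"
    using inv by (intro exI[of _ 0]) simp
next
  fix s :: state
  assume "\<exists>j. decr_inv n m0 k c v j (fst s) \<and>
      snd s = mem (n * n) m0 (decreased (adj n m0) v X j)" "0 < fst s 16"
  then obtain r' j where s: "s = (r', mem (n * n) m0 (decreased (adj n m0) v X j))"
      and j: "decr_inv n m0 k c v j r'" "j < n"
    by (cases s) (auto simp: decr_inv_def)
  define d where "d = n - j"
  have reg: "r' 4 = 1" "r' 16 = d" "r' 17 = n * n + j" "r' 23 = v * n + j"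
      "r' 14 = 1" "r' 15 = v * n + n" and row: "row_inv n m0 k c v r'" and d: "d > 0"
    using j by (auto simp: decr_inv_def row_inv_def env_def d_def)
  have step: "decr_inv n m0 k c v (Suc j) r''"
    if "row_inv n m0 k c v r''" "r'' 14 = 1" "r'' 15 = v * n + n" "r'' 16 = d - 1"
      "r'' 17 = n * n + Suc j" "r'' 23 = v * n + Suc j" for r''
    using that j by (auto simp: decr_inv_def d_def)
  show "wp decr_body (\<lambda>t s'. t \<le> 10 \<and>
      (\<exists>j. decr_inv n m0 k c v j (fst s') \<and>
        snd s' = mem (n * n) m0 (decreased (adj n m0) v X j)) \<and> fst s' 16 < fst s 16) s"
    using row d entry_less[OF v j(2)] unfolding s
    by (cases "adj n m0 v j")
      (auto simp: decr_body_def reg adj_def decreased_Suc intro!: exI[of _ "Suc j"] step)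
next
  fix t and s' :: state
  assume "\<exists>j. decr_inv n m0 k c v j (fst s') \<and>
      snd s' = mem (n * n) m0 (decreased (adj n m0) v X j)"
    "fst s' 16 = 0" and t: "t \<le> fst (r, mem (n * n) m0 X) 16 * (10 + 1) + 1"
  then obtain j where j: "decr_inv n m0 k c v j (fst s')"
      "snd s' = mem (n * n) m0 (decreased (adj n m0) v X j)"
    by blast
  then have "j = n" using \<open>fst s' 16 = 0\<close> by (auto simp: decr_inv_def)
  moreover have "r 16 = n" using inv by (simp add: decr_inv_def)
  ultimately show "t \<le> 11 * n + 1 \<and> decr_inv n m0 k c v n (fst s') \<and>
      snd s' = mem (n * n) m0 (decreased (adj n m0) v X n)"
    using j t by auto
qed

text \<open>The flag is read backwards: if register 14 is 0 at the end, nothing had changed before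
  and the test found the sum small. This is how a quiet sweep yields certificates.\<close>

lemma decr_step:
  assumes row: "row_inv n m0 k c v r" and v: "v < n" and p: "r 15 = v * n + n"
    and low: "r 19 \<le> sum X (nbrs n (adj n m0) v)" and pro: "progress n (adj n m0) k (r 14) X0 X"
    and k: "k < card (nbrs n (adj n m0) v)"
  shows "wp decr_step (\<lambda>t s'. t \<le> 11 * n + 20 \<and>
    (\<exists>X'. row_inv n m0 k c v (fst s') \<and> fst s' 15 = v * n + n \<and>
       progress n (adj n m0) k (fst s' 14) X0 X' \<and> snd s' = mem (n * n) m0 X' \<and>
       (fst s' 14 = 0 \<longrightarrow> r 14 = 0 \<and> r 19 < (k - 1) * full n + n))) (r, mem (n * n) m0 X)"
proof -
  let ?A = "adj n m0"
  have reg: "r 4 = 1" "r 10 = (k - 1) * full n + n" "r 2 = n" "r 3 = n * n"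
    using row by (auto simp: row_inv_def env_def)
  show ?thesis
  proof (cases "r 19 < (k - 1) * full n + n")
    case True
    then show ?thesis using row p pro by (auto simp: decr_step_def reg)
  next
    case False
    have pro': "progress n ?A k (Suc 0) X0 (decreased ?A v X n)"
    proof (rule progress_step[OF pro])
      show "\<forall>u<n. decreased ?A v X n u \<le> full n"
        using pro by (auto simp: progress_def decreased_def le_diff_conv le_SucI)
      show "potential n H (decreased ?A v X n) + 1 \<le> potential n H X" if "feasible n ?A k H" for H
        unfolding decreased_def using potential_nbrs_step[OF that v k] False low by simp
    qed
    have "wp (While_Pos 16 decr_body) (\<lambda>t s'. t \<le> 11 * n + 1 \<and>
      decr_inv n m0 k c v n (fst s') \<and> snd s' = mem (n * n) m0 (decreased (adj n m0) v X n))
      (r', mem (n * n) m0 X)"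
      if "decr_inv n m0 k c v 0 r'" for r'
      using decr_loop[OF that v] .
    note loop = wp_mono[OF this]
    show ?thesis
      using False row p pro'
      by (auto simp: decr_step_def reg decr_inv_def intro!: loop)
  qed
qed

text \<open>That \<open>X\<close> only grows keeps register 19 a lower bound for the neighbour sum,
  as the following test in \<open>decr_step\<close> requires.\<close>

lemma raise_step:
  assumes row: "row_inv n m0 k c v r" and v: "v < n"
    and pro: "progress n (adj n m0) k (r 14) X0 X" and k: "k < card (nbrs n (adj n m0) v)"
  shows "wp raise_step (\<lambda>t s'. t \<le> 10 \<and>
    (\<exists>X'. row_inv n m0 k c v (fst s') \<and> fst s' 15 = r 15 \<and> fst s' 19 = r 19 \<and>
       (\<forall>u. X u \<le> X' u) \<and>
       progress n (adj n m0) k (fst s' 14) X0 X' \<and> snd s' = mem (n * n) m0 X' \<and>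
       (fst s' 14 = 0 \<longrightarrow> r 14 = 0 \<and> half n \<le> X v))) (r, mem (n * n) m0 X)"
proof -
  have reg: "r 4 = 1" "r 5 = half n" "r 13 = n * n + v"
    using row by (auto simp: row_inv_def env_def)
  show ?thesis
  proof (cases "X v < half n")
    case True
    have pro': "progress n (adj n m0) k (Suc 0) X0 (X(v := Suc (X v)))"
    proof (rule progress_step[OF pro])
      show "\<forall>u<n. (X(v := Suc (X v))) u \<le> full n"
        using pro True by (auto simp: progress_def full_def)
    qed (use potential_big_step[OF _ v k] True in blast)
    show ?thesis
      using True row pro'
      by (auto simp: raise_step_def reg intro!: exI[of _ "X(v := Suc (X v))"])
  next
    case False
    then show ?thesis
      using row pro by (auto simp: raise_step_def reg intro!: exI[of _ X])
  qed
qed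

definition sweep_inv where
  "sweep_inv n m0 k c X0 X v r \<longleftrightarrow>
     row_inv n m0 k c v r \<and> v \<le> n \<and> r 15 = v * n \<and> progress n (adj n m0) k (r 14) X0 X \<and>
     (r 14 = 0 \<longrightarrow> (\<forall>w<v. settled n (adj n m0) k X0 w))"

text \<open>The edge loop comes first because it also computes the degree in register 18 and the
  neighbour sum in register 19, on which the treatment of big vertices depends.\<close>

lemma row_body:
  assumes inv: "sweep_inv n m0 k c X0 X v r" and v: "v < n"
  shows "wp row_body (\<lambda>t s'. t \<le> 32 * n + 60 \<and>
    (\<exists>X v. sweep_inv n m0 k c X0 X v (fst s') \<and> snd s' = mem (n * n) m0 X) \<and>
    fst s' 12 < r 12) (r, mem (n * n) m0 X)"
proof -
  let ?A = "adj n m0"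
  have reg: "r 2 = n" "r 3 = n * n" and row: "row_inv n m0 k c v r"
    and p: "r 15 = v * n" and pro: "progress n ?A k (r 14) X0 X"
    and set: "r 14 = 0 \<Longrightarrow> \<forall>w<v. settled n ?A k X0 w"
    using inv by (auto simp: sweep_inv_def row_inv_def env_def)
  have finish: "wp (Add 13 13 4 ;; Sub 12 12 4)
      (\<lambda>t s'. t \<le> 2 \<and>
        (\<exists>X v. sweep_inv n m0 k c X0 X v (fst s') \<and> snd s' = mem (n * n) m0 X) \<and>
        fst s' 12 < r 12) (r', mem (n * n) m0 X')"
    if "row_inv n m0 k c v r'" "r' 15 = v * n + n" "progress n ?A k (r' 14) X0 X'"
      "r' 14 = 0 \<Longrightarrow> \<forall>w<Suc v. settled n ?A k X0 w" for r' X'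
  proof -
    have "sweep_inv n m0 k c X0 X' (Suc v) (r'(13 := Suc (n * n + v), 12 := n - v - 1))"
      using that v by (auto simp: sweep_inv_def row_inv_def env_def)
    then show ?thesis
      using that(1) row v by (auto simp: row_inv_def env_def)
  qed
  have big: "wp (raise_step ;; decr_step)
      (\<lambda>t s'. t \<le> 11 * n + 30 \<and>
        (\<exists>X2. row_inv n m0 k c v (fst s') \<and> fst s' 15 = v * n + n \<and>
           progress n ?A k (fst s' 14) X0 X2 \<and> snd s' = mem (n * n) m0 X2 \<and>
           (fst s' 14 = 0 \<longrightarrow> r' 14 = 0 \<and> half n \<le> X' v \<and> r' 19 < (k - 1) * full n + n)))
      (r', mem (n * n) m0 X')"
    if r': "row_inv n m0 k c v r'" "r' 15 = v * n + n" "progress n ?A k (r' 14) X0 X'"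
      "r' 19 \<le> sum X' (nbrs n ?A v)" and k: "k < card (nbrs n ?A v)" for r' X'
    unfolding wp_Seq
  proof (rule wp_mono[OF raise_step[OF r'(1) v r'(3) k]])
    fix t :: nat and r1 m
    assume "t \<le> 10 \<and>
      (\<exists>X1. row_inv n m0 k c v (fst (r1, m)) \<and> fst (r1, m) 15 = r' 15 \<and>
         fst (r1, m) 19 = r' 19 \<and> (\<forall>u. X' u \<le> X1 u) \<and>
         progress n ?A k (fst (r1, m) 14) X0 X1 \<and> snd (r1, m) = mem (n * n) m0 X1 \<and>
         (fst (r1, m) 14 = 0 \<longrightarrow> r' 14 = 0 \<and> half n \<le> X' v))"
    then obtain X1 where X1: "t \<le> 10" "row_inv n m0 k c v r1" "r1 15 = v * n + n"
        "r1 19 = r' 19" "\<forall>u. X' u \<le> X1 u" "progress n ?A k (r1 14) X0 X1"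
        "m = mem (n * n) m0 X1" "r1 14 = 0 \<longrightarrow> r' 14 = 0 \<and> half n \<le> X' v"
      using r'(2) by auto
    have "sum X' (nbrs n ?A v) \<le> sum X1 (nbrs n ?A v)" using X1(5) by (intro sum_mono) simp
    then have low: "r1 19 \<le> sum X1 (nbrs n ?A v)" using X1(4) r'(4) by simp
    show "wp decr_step (\<lambda>t'. (\<lambda>t s'. t \<le> 11 * n + 30 \<and>
        (\<exists>X2. row_inv n m0 k c v (fst s') \<and> fst s' 15 = v * n + n \<and>
           progress n ?A k (fst s' 14) X0 X2 \<and> snd s' = mem (n * n) m0 X2 \<and>
           (fst s' 14 = 0 \<longrightarrow> r' 14 = 0 \<and> half n \<le> X' v \<and> r' 19 < (k - 1) * full n + n)))
        (t + t')) (r1, m)"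
      unfolding X1(7)
      by (rule wp_mono[OF decr_step[OF X1(2) v X1(3) low X1(6) k]])
        (use X1(1,4,8) in fastforce)
  qed
  have start: "edge_inv n m0 k c v X0 X 0 r'"
    if "row_inv n m0 k c v r'" "r' 14 = r 14" "r' 15 = v * n" "r' 16 = n" "r' 17 = n * n"
      "r' 18 = 0" "r' 19 = 0" for r'
    using that v pro set by (auto simp: edge_inv_def)
  \<comment> \<open>With the flag at 0, the array is \<open>X0\<close> and register 19 is exact, so
    the tests passed in this row are the constraints of \<open>settled\<close> at
    \<open>v\<close>.\<close>
  have row_end: "settled n ?A k X0 w"
    if e: "edge_inv n m0 k c v X0 X' n r'" and g: "r' 14 = 0" and w: "w < Suc v"
      and small: "k < card (nbrs n ?A v) \<Longrightarrow> half n \<le> X' v \<and> r' 19 < (k - 1) * full n + n"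
      for r' X' w
    using e g w small by (auto simp: edge_inv_def settled_def progress_def less_Suc_eq)
  have rest: "wp (Sub 22 18 9 ;; If_Pos 22 (raise_step ;; decr_step) skip ;;
      Add 13 13 4 ;; Sub 12 12 4)
      (\<lambda>t s'. t \<le> 11 * n + 35 \<and>
        (\<exists>X v. sweep_inv n m0 k c X0 X v (fst s') \<and> snd s' = mem (n * n) m0 X) \<and>
        fst s' 12 < r 12) (r', mem (n * n) m0 X')"
    if e: "edge_inv n m0 k c v X0 X' n r'" for r' X'
  proof -
    let ?r = "r'(22 := r' 18 - k)"
    have facts: "row_inv n m0 k c v r'" "r' 15 = v * n + n" "progress n ?A k (r' 14) X0 X'"
      "r' 19 \<le> sum X' (nbrs n ?A v)" "r' 18 = card (nbrs n ?A v)" "r' 9 = k"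
      using e by (auto simp: edge_inv_def row_inv_def env_def)
    show ?thesis
    proof (cases "k < card (nbrs n ?A v)")
      case True
      have "wp (raise_step ;; decr_step)
        (\<lambda>t. wp (Add 13 13 4 ;; Sub 12 12 4) (\<lambda>t' s'. Suc (Suc (t + t')) \<le> 11 * n + 35 \<and>
          (\<exists>X v. sweep_inv n m0 k c X0 X v (fst s') \<and> snd s' = mem (n * n) m0 X) \<and>
          fst s' 12 < r 12)) (?r, mem (n * n) m0 X')"
      proof (rule wp_mono[OF big[of ?r]])
        fix t :: nat and r2 m
        assume "t \<le> 11 * n + 30 \<and>
          (\<exists>X'a. row_inv n m0 k c v (fst (r2, m)) \<and> fst (r2, m) 15 = v * n + n \<and>
             progress n ?A k (fst (r2, m) 14) X0 X'a \<and> snd (r2, m) = mem (n * n) m0 X'a \<and>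
             (fst (r2, m) 14 = 0 \<longrightarrow>
                ?r 14 = 0 \<and> half n \<le> X' v \<and> ?r 19 < (k - 1) * full n + n))"
        then obtain X2 where X2: "t \<le> 11 * n + 30" "row_inv n m0 k c v r2" "r2 15 = v * n + n"
            "progress n ?A k (r2 14) X0 X2" "m = mem (n * n) m0 X2"
            "r2 14 = 0 \<longrightarrow> r' 14 = 0 \<and> half n \<le> X' v \<and> r' 19 < (k - 1) * full n + n"
          by auto
        have "\<forall>w<Suc v. settled n ?A k X0 w" if "r2 14 = 0"
          using X2(6) that row_end[OF e] by blast
        from finish[OF X2(2,3,4) this]
        show "wp (Add 13 13 4 ;; Sub 12 12 4) (\<lambda>t' s'. Suc (Suc (t + t')) \<le> 11 * n + 35 \<and>
          (\<exists>X v. sweep_inv n m0 k c X0 X v (fst s') \<and> snd s' = mem (n * n) m0 X) \<and>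
          fst s' 12 < r 12) (r2, m)"
          unfolding X2(5) by (rule wp_mono) (use X2(1) in auto)
      qed (use facts True in auto)
      then show ?thesis using True facts by (simp add: add.assoc)
    next
      case False
      have "\<forall>w<Suc v. settled n ?A k X0 w" if "r' 14 = 0"
        using that row_end[OF e] False by blast
      then have "wp (Add 13 13 4 ;; Sub 12 12 4)
        (\<lambda>t s'. t \<le> 2 \<and>
          (\<exists>X v. sweep_inv n m0 k c X0 X v (fst s') \<and> snd s' = mem (n * n) m0 X) \<and>
          fst s' 12 < r 12) (r'(22 := 0), mem (n * n) m0 X')"
        using facts by (intro finish) auto
      then show ?thesis using False facts by simp
    qed
  qed
  let ?rest = "Sub 22 18 9 ;; If_Pos 22 (raise_step ;; decr_step) skip ;; Add 13 13 4 ;; Sub 12 12 4"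
  have main: "wp (While_Pos 16 edge_body ;; ?rest)
      (\<lambda>t s'. t \<le> 32 * n + 40 \<and>
        (\<exists>X v. sweep_inv n m0 k c X0 X v (fst s') \<and> snd s' = mem (n * n) m0 X) \<and>
        fst s' 12 < r 12) (r', mem (n * n) m0 X)"
    if "edge_inv n m0 k c v X0 X 0 r'" for r'
    unfolding wp_Seq[of "While_Pos 16 edge_body"]
  proof (rule wp_mono[OF edge_loop[OF that]])
    fix t :: nat and r1 m
    assume "t \<le> 21 * n + 1 \<and>
      (\<exists>X. edge_inv n m0 k c v X0 X n (fst (r1, m)) \<and> snd (r1, m) = mem (n * n) m0 X)"
    then obtain X1 where t: "t \<le> 21 * n + 1" and X1: "edge_inv n m0 k c v X0 X1 n r1"
        "m = mem (n * n) m0 X1"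
      by auto
    show "wp ?rest (\<lambda>t'. (\<lambda>t s'. t \<le> 32 * n + 40 \<and>
        (\<exists>X v. sweep_inv n m0 k c X0 X v (fst s') \<and> snd s' = mem (n * n) m0 X) \<and>
        fst s' 12 < r 12) (t + t')) (r1, m)"
      unfolding X1(2) by (rule wp_mono[OF rest[OF X1(1)]]) (use t in auto)
  qed
  show ?thesis
    unfolding row_body_def
    by (simp del: wp_Seq add: wp_Seq[of "Const _ _"] wp_Seq[of "Add _ _ _"] reg)
      (rule wp_mono[OF main[OF start]], use row p in auto)
qed

text \<open>A sweep that ends with the flag at 0 has checked every constraint against one unchanged
  array. Otherwise at least one update has lowered the potential for every feasible
  \<open>H\<close>.\<close>

lemma sweep:
  assumes r: "env n k r" "r 11 = c" and X: "\<forall>u<n. X u \<le> full n"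
  shows "wp sweep (\<lambda>t s'. t \<le> n * (32 * n + 61) + 10 \<and>
    (\<exists>X'. env n k (fst s') \<and> fst s' 11 = c \<and> snd s' = mem (n * n) m0 X' \<and>
       progress n (adj n m0) k (fst s' 14) X X' \<and>
       (fst s' 14 = 0 \<longrightarrow> (\<forall>v<n. settled n (adj n m0) k X v)))) (r, mem (n * n) m0 X)"
proof -
  have reg: "r 2 = n" "r 3 = n * n" using r by (auto simp: env_def)
  let ?post = "\<lambda>t s'. t \<le> n * (32 * n + 61) + 1 \<and>
    (\<exists>X'. sweep_inv n m0 k c X X' n (fst s') \<and> snd s' = mem (n * n) m0 X')"
  have loop: "wp (While_Pos 12 row_body) ?post (r', mem (n * n) m0 X)"
    if inv: "sweep_inv n m0 k c X X 0 r'" for r'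
  proof (rule wp_While[where T = "32 * n + 60" and \<mu> = "\<lambda>s. fst s 12"
        and Inv = "\<lambda>s. \<exists>X' v. sweep_inv n m0 k c X X' v (fst s) \<and> snd s = mem (n * n) m0 X'"])
    show "\<exists>X' v. sweep_inv n m0 k c X X' v (fst (r', mem (n * n) m0 X)) \<and>
        snd (r', mem (n * n) m0 X) = mem (n * n) m0 X'"
      using inv by auto
  next
    fix s :: state
    assume "\<exists>X' v. sweep_inv n m0 k c X X' v (fst s) \<and> snd s = mem (n * n) m0 X'" "0 < fst s 12"
    then obtain X' v where X': "sweep_inv n m0 k c X X' v (fst s)" "snd s = mem (n * n) m0 X'"
      by blast
    moreover have "v < n" using X'(1) \<open>0 < fst s 12\<close> by (auto simp: sweep_inv_def row_inv_def)
    ultimately show "wp row_body (\<lambda>t s'. t \<le> 32 * n + 60 \<and>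
        (\<exists>X' v. sweep_inv n m0 k c X X' v (fst s') \<and> snd s' = mem (n * n) m0 X') \<and>
        fst s' 12 < fst s 12) s"
      using row_body[of n m0 k c X X' v "fst s"] by (cases s) simp
  next
    fix t and s' :: state
    assume "\<exists>X' v. sweep_inv n m0 k c X X' v (fst s') \<and> snd s' = mem (n * n) m0 X'"
      "fst s' 12 = 0" and t: "t \<le> fst (r', mem (n * n) m0 X) 12 * (32 * n + 60 + 1) + 1"
    then obtain X' v where X': "sweep_inv n m0 k c X X' v (fst s')" "snd s' = mem (n * n) m0 X'"
      by blast
    then have "v = n" using \<open>fst s' 12 = 0\<close> by (auto simp: sweep_inv_def row_inv_def)
    moreover have "r' 12 = n" using inv by (simp add: sweep_inv_def row_inv_def)
    then have "t \<le> n * (32 * n + 61) + 1" using t by (simp add: add.commute)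
    ultimately show "?post t s'" using X' by auto
  qed
  have start: "sweep_inv n m0 k c X X 0 r'"
    if "env n k r'" "r' 11 = c" "r' 12 = n" "r' 13 = n * n" "r' 14 = 0" "r' 15 = 0" for r'
    using that X by (auto simp: sweep_inv_def row_inv_def progress_refl)
  show ?thesis
    unfolding sweep_def
    by (simp add: reg) (rule wp_mono[OF loop[OF start]], use r in \<open>auto simp: sweep_inv_def row_inv_def\<close>)
qed

section \<open>The search for the least \<open>k\<close> not refuted by the potential\<close>

text \<open>
  Register 11 bounds the potential for every \<open>H\<close> that is feasible for \<open>k\<close>, so when it reaches
  \<open>0\<close> there is none and \<open>k\<close> may be increased.
\<close>
definition search_inv where
  "search_inv n m0 k X r \<longleftrightarrow>
     env n k r \<and> 1 \<le> k \<and> (\<forall>u<n. X u \<le> full n) \<and> 0 < r 11 \<and> r 11 \<le> Suc (n * full n * full n) \<and>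
     (\<forall>H. feasible n (adj n m0) k H \<longrightarrow> potential n H X < int (r 11)) \<and>
     (\<forall>k' H. 1 \<le> k' \<longrightarrow> feasible n (adj n m0) k' H \<longrightarrow> k \<le> k') \<and>
     (r 14 = 0 \<longrightarrow> (\<forall>v<n. settled n (adj n m0) k X v))"

text \<open>A bound on the sweeps left: one full budget for each value of \<open>k\<close> still
  ahead up to \<open>n + 1\<close>, plus the rest of the current budget.\<close>

definition search_measure where
  "search_measure n r =
     (if r 14 = 0 then 0 else (Suc n - r 9) * Suc (n * full n * full n) + r 11)"

lemma search_body:
  assumes inv: "search_inv n m0 k X r" and pos: "r 14 > 0"
  shows "wp search_body (\<lambda>t s'. t \<le> n * (32 * n + 61) + 20 \<and>
    (\<exists>X k. search_inv n m0 k X (fst s') \<and> snd s' = mem (n * n) m0 X) \<and>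
    search_measure n (fst s') < search_measure n r) (r, mem (n * n) m0 X)"
proof -
  let ?A = "adj n m0" and ?R = "Suc (n * full n * full n)"
  define c where "c = r 11"
  have env: "env n k r" and k: "1 \<le> k" and X: "\<forall>u<n. X u \<le> full n" and c: "0 < c" "c \<le> ?R"
    and pot: "\<And>H. feasible n ?A k H \<Longrightarrow> potential n H X < int c"
    and least: "\<And>k' H. 1 \<le> k' \<Longrightarrow> feasible n ?A k' H \<Longrightarrow> k \<le> k'"
    using inv by (auto simp: search_inv_def c_def)
  have measure: "search_measure n r = (Suc n - k) * ?R + c"
    using pos env by (simp add: search_measure_def c_def env_def)
  show ?thesis
    unfolding search_body_def wp_Seq
  proof (rule wp_mono[OF sweep[OF env c_def[symmetric] X, where ?m0.0 = m0]])
    fix t :: nat and r1 m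
    assume "t \<le> n * (32 * n + 61) + 10 \<and>
      (\<exists>X'. env n k (fst (r1, m)) \<and> fst (r1, m) 11 = c \<and> snd (r1, m) = mem (n * n) m0 X' \<and>
         progress n ?A k (fst (r1, m) 14) X X' \<and>
         (fst (r1, m) 14 = 0 \<longrightarrow> (\<forall>v<n. settled n ?A k X v)))"
    then obtain X1 where t: "t \<le> n * (32 * n + 61) + 10" and r1: "env n k r1" "r1 11 = c"
        and m: "m = mem (n * n) m0 X1" and pro: "progress n ?A k (r1 14) X X1"
        and set: "r1 14 = 0 \<longrightarrow> (\<forall>v<n. settled n ?A k X v)"
      by auto
    have X1: "\<forall>u<n. X1 u \<le> full n" using pro by (simp add: progress_def)
    have reg: "r1 4 = 1" "r1 7 = full n" "r1 8 = ?R" "r1 9 = k"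
      using r1 by (auto simp: env_def)
    consider (stop) "r1 14 = 0" | (go) "r1 14 > 0" "c > 1" | (inc) "r1 14 > 0" "c = 1"
      using c by linarith
    then show "wp (If_Pos 14
       (Sub 11 11 4 ;;
        If_Pos 11 skip (Add 9 9 4 ;; Add 10 10 7 ;; Const 11 0 ;; Add 11 11 8))
       skip) (\<lambda>t'. (\<lambda>t s'. t \<le> n * (32 * n + 61) + 20 \<and>
        (\<exists>X k. search_inv n m0 k X (fst s') \<and> snd s' = mem (n * n) m0 X) \<and>
        search_measure n (fst s') < search_measure n r) (t + t')) (r1, m)"
    proof cases
      case stop
      then have "X1 = X" using pro by (simp add: progress_def)
      then have "search_inv n m0 k X1 (r1(22 := 0))"
        using r1 set stop k X c pot least by (auto simp: search_inv_def)
      moreover have "search_measure n (r1(22 := 0)) < search_measure n r"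
        using stop c by (simp add: measure) (simp add: search_measure_def)
      ultimately show ?thesis using stop t m by auto
    next
      case go
      have "potential n H X1 < int (c - 1)" if "feasible n ?A k H" for H
        using pro pot[OF that] that go by (fastforce simp: progress_def)
      then have "search_inv n m0 k X1 (r1(11 := c - 1, 22 := 0))"
        using r1 go k X1 c least by (auto simp: search_inv_def)
      moreover have "search_measure n (r1(11 := c - 1, 22 := 0)) < search_measure n r"
        using go reg by (simp add: measure) (simp add: search_measure_def)
      ultimately show ?thesis using go t m reg r1 by auto
    next
      case inc
      let ?r = "r1(9 := Suc k, 10 := r1 10 + full n, 11 := ?R)"
      \<comment> \<open>The potential was below 1 before the sweep and dropped by at least 1, so for
        a feasible \<open>H\<close> it would now be negative.\<close>
      have infeasible: "\<not> feasible n ?A k H" for H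
      proof
        assume H: "feasible n ?A k H"
        then have "potential n H X1 + 1 \<le> potential n H X"
          using pro inc by (simp add: progress_def)
        then show False using pot[OF H] potential_nonneg[of n H X1] inc by simp
      qed
      have least': "Suc k \<le> k'" if "1 \<le> k'" "feasible n ?A k' H" for k' H
        using least[OF that] that infeasible by (cases "k = k'") auto
      have "env n (Suc k) ?r"
        using r1 k by (cases k) (auto simp: env_def)
      \<comment> \<open>The array need not be reset for the next \<open>k\<close>: a full budget
        bounds the potential of any array with entries at most \<open>full n\<close>.\<close>
      moreover have "potential n H X1 < int ?R" for H
        using potential_le[OF X1, of H] by linarith
      ultimately have "search_inv n m0 (Suc k) X1 ?r"
        using inc X1 least' by (simp add: search_inv_def)
      moreover have "search_measure n ?r < search_measure n r"
      proof -
        \<comment> \<open>Thus the subtraction in the measure is not truncated, and increasing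
          \<open>k\<close> frees one full budget.\<close>
        have "Suc k \<le> Suc n" using least'[OF _ feasible_UNIV] by simp
        then have "Suc n - k = Suc (n - k)" by simp
        then have "(Suc n - Suc k) * ?R + ?R = (Suc n - k) * ?R"
          by (simp only: diff_Suc_Suc mult_Suc[of "n - k"] add.commute)
        then show ?thesis
          using inc unfolding measure by (simp add: search_measure_def)
      qed
      ultimately show ?thesis using inc t m reg r1 by auto
    qed
  qed
qed

lemma search:
  assumes inv: "search_inv n m0 1 X r" and R: "r 11 = Suc (n * full n * full n)"
  shows "wp (While_Pos 14 search_body) (\<lambda>t s'.
    t \<le> Suc n * Suc (n * full n * full n) * (n * (32 * n + 61) + 21) + 1 \<and>
    (\<exists>X k. search_inv n m0 k X (fst s') \<and> fst s' 14 = 0 \<and> snd s' = mem (n * n) m0 X))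
    (r, mem (n * n) m0 X)"
proof (rule wp_While[where T = "n * (32 * n + 61) + 20" and \<mu> = "\<lambda>s. search_measure n (fst s)"
      and Inv = "\<lambda>s. \<exists>X k. search_inv n m0 k X (fst s) \<and> snd s = mem (n * n) m0 X"])
  show "\<exists>X' k. search_inv n m0 k X' (fst (r, mem (n * n) m0 X)) \<and>
      snd (r, mem (n * n) m0 X) = mem (n * n) m0 X'"
    using inv by auto
next
  fix s :: state
  assume "\<exists>X k. search_inv n m0 k X (fst s) \<and> snd s = mem (n * n) m0 X" and pos: "0 < fst s 14"
  then obtain X k where "search_inv n m0 k X (fst s)" "snd s = mem (n * n) m0 X"
    by blast
  then show "wp search_body (\<lambda>t s'. t \<le> n * (32 * n + 61) + 20 \<and>
      (\<exists>X k. search_inv n m0 k X (fst s') \<and> snd s' = mem (n * n) m0 X) \<and>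
      search_measure n (fst s') < search_measure n (fst s)) s"
    using search_body[of n m0 k X "fst s"] pos by (cases s) simp
next
  fix t and s' :: state
  assume post: "\<exists>X k. search_inv n m0 k X (fst s') \<and> snd s' = mem (n * n) m0 X" "fst s' 14 = 0"
    and t: "t \<le> search_measure n (fst (r, mem (n * n) m0 X)) * (n * (32 * n + 61) + 20 + 1) + 1"
  \<comment> \<open>At \<open>k = 1\<close> there are \<open>n\<close> further budgets besides the
    current one.\<close>
  have "search_measure n r \<le> Suc n * Suc (n * full n * full n)"
    using inv R by (simp add: search_measure_def search_inv_def env_def)
  then have "search_measure n r * (n * (32 * n + 61) + 21)
      \<le> Suc n * Suc (n * full n * full n) * (n * (32 * n + 61) + 21)"
    by (rule mult_le_mono1)
  moreover have "t \<le> search_measure n r * (n * (32 * n + 61) + 21) + 1"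
    using t by (simp add: add.commute)
  ultimately have "t \<le> Suc n * Suc (n * full n * full n) * (n * (32 * n + 61) + 21) + 1"
    by linarith
  then show "t \<le> Suc n * Suc (n * full n * full n) * (n * (32 * n + 61) + 21) + 1 \<and>
      (\<exists>X k. search_inv n m0 k X (fst s') \<and> fst s' 14 = 0 \<and> snd s' = mem (n * n) m0 X)"
    using post by blast
qed

section \<open>Shrinking to a minimal cover\<close>

definition has_outer :: "nat \<Rightarrow> (nat \<Rightarrow> nat \<Rightarrow> bool) \<Rightarrow> (nat \<Rightarrow> nat) \<Rightarrow> nat \<Rightarrow> bool" where
  "has_outer n A X v \<longleftrightarrow> (\<exists>u<n. A v u \<and> X u < half n)"

text \<open>The cover is represented by \<open>X\<close> itself, as the vertices with value at least
  \<open>half n\<close>. A vertex whose neighbours are all in the cover is removed by writing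
  0.\<close>

primrec shrunk :: "nat \<Rightarrow> (nat \<Rightarrow> nat \<Rightarrow> bool) \<Rightarrow> (nat \<Rightarrow> nat) \<Rightarrow> nat \<Rightarrow> nat \<Rightarrow> nat" where
  "shrunk n A X 0 = X"
| "shrunk n A X (Suc v) =
     (if has_outer n A (shrunk n A X v) v then shrunk n A X v else (shrunk n A X v)(v := 0))"

lemma shrunk_le: "shrunk n A X v u \<le> X u"
  by (induction v) auto

text \<open>A vertex is removed only while all its neighbours are in the cover, so each of its edges
  keeps its other end; the absence of loops makes that end a different vertex.\<close>

lemma shrunk_cover:
  assumes "\<forall>v<n. \<forall>u<n. A v u \<longrightarrow> A u v \<and> u \<noteq> v"
    and "\<forall>v<n. \<forall>u<n. A v u \<longrightarrow> half n \<le> X v \<or> half n \<le> X u" and "w \<le> n"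
  shows "\<forall>v<n. \<forall>u<n. A v u \<longrightarrow> half n \<le> shrunk n A X w v \<or> half n \<le> shrunk n A X w u"
  using \<open>w \<le> n\<close>
proof (induction w)
  case (Suc w)
  let ?Y = "shrunk n A X w"
  have IH: "\<And>v u. v < n \<Longrightarrow> u < n \<Longrightarrow> A v u \<Longrightarrow> half n \<le> ?Y v \<or> half n \<le> ?Y u"
    using Suc.IH Suc.prems by (meson Suc_leD)
  show ?case
  proof (cases "has_outer n A ?Y w")
    case True
    with IH show ?thesis by simp
  next
    case False
    then have out: "half n \<le> ?Y u" if "u < n" "A w u" for u
      using that by (auto simp: has_outer_def not_less)
    have eq: "shrunk n A X (Suc w) = ?Y(w := 0)" using False by simp
    have "half n \<le> (?Y(w := 0)) v \<or> half n \<le> (?Y(w := 0)) u"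
      if "v < n" "u < n" "A v u" for v u
    proof -
      have "A u v" "u \<noteq> v" using assms(1) that by auto
      with IH[OF that] out[of u] out[of v] that show ?thesis by (cases "v = w"; cases "u = w") auto
    qed
    then show ?thesis unfolding eq by blast
  qed
qed (use assms(2) in simp)

text \<open>One pass suffices: values never increase, so a neighbour that was outside when a vertex
  was examined stays outside.\<close>

lemma shrunk_minimal:
  "w \<le> n \<Longrightarrow> \<forall>v<w. half n \<le> shrunk n A X w v \<longrightarrow> has_outer n A (shrunk n A X w) v"
proof (induction w)
  case (Suc w)
  let ?Y = "shrunk n A X w"
  have IH: "has_outer n A ?Y v" if "v < w" "half n \<le> ?Y v" for v
    using Suc.IH Suc.prems that by (meson Suc_leD)
  show ?case
  proof (cases "has_outer n A ?Y w")
    case True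
    with IH show ?thesis by (auto simp: less_Suc_eq)
  next
    case False
    have eq: "shrunk n A X (Suc w) = ?Y(w := 0)" using False by simp
    \<comment> \<open>Here \<open>n > 0\<close>, so the value 0 lies below the threshold and really
      removes the vertex.\<close>
    have "half n > 0" using Suc.prems by (simp add: half_def)
    have "has_outer n A (?Y(w := 0)) v" if "v < Suc w" "half n \<le> (?Y(w := 0)) v" for v
    proof -
      have "v < w" "half n \<le> ?Y v"
        using that \<open>half n > 0\<close> by (auto split: if_splits)
      from IH[OF this] show ?thesis using \<open>half n > 0\<close>
        unfolding has_outer_def fun_upd_apply by metis
    qed
    then show ?thesis unfolding eq by blast
  qed
qed simp

lemma scan_loop:
  assumes row: "row_inv n m0 k c v r" and v: "v < n" and r: "r 15 = v * n" "r 16 = n"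
    "r 17 = n * n" "r 18 = 0"
  shows "wp (While_Pos 16 scan_body) (\<lambda>t s'. t \<le> 11 * n + 1 \<and>
    row_inv n m0 k c v (fst s') \<and> fst s' 15 = v * n + n \<and> snd s' = mem (n * n) m0 X \<and>
    (fst s' 18 > 0 \<longleftrightarrow> has_outer n (adj n m0) X v)) (r, mem (n * n) m0 X)"
proof -
  let ?A = "adj n m0"
  define J where "J j r \<longleftrightarrow> row_inv n m0 k c v r \<and> r 15 = v * n + j \<and> r 16 = n - j \<and>
    r 17 = n * n + j \<and> (r 18 > 0 \<longleftrightarrow> (\<exists>u<j. ?A v u \<and> X u < half n))" for j and r :: "nat \<Rightarrow> nat"
  show ?thesis
  proof (rule wp_While[where T = 10 and \<mu> = "\<lambda>s. fst s 16"
        and Inv = "\<lambda>s. \<exists>j\<le>n. J j (fst s) \<and> snd s = mem (n * n) m0 X"])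
    show "\<exists>j\<le>n. J j (fst (r, mem (n * n) m0 X)) \<and> snd (r, mem (n * n) m0 X) = mem (n * n) m0 X"
      using row r by (intro exI[of _ 0]) (simp add: J_def)
  next
    fix s :: state
    assume "\<exists>j\<le>n. J j (fst s) \<and> snd s = mem (n * n) m0 X" "0 < fst s 16"
    then obtain j r' where s: "s = (r', mem (n * n) m0 X)" and J: "J j r'" and "j \<le> n" "0 < r' 16"
      by (cases s) auto
    then have j: "j < n" unfolding J_def by linarith
    define d where "d = n - j"
    have reg: "r' 4 = 1" "r' 5 = half n" "r' 15 = v * n + j" "r' 16 = d" "r' 17 = n * n + j"
      and row': "row_inv n m0 k c v r'" and d: "d > 0"
      and flag: "r' 18 > 0 \<longleftrightarrow> (\<exists>u<j. ?A v u \<and> X u < half n)"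
      using J j by (auto simp: J_def row_inv_def env_def d_def)
    have step: "J (Suc j) r''"
      if "row_inv n m0 k c v r''" "r'' 15 = v * n + Suc j" "r'' 16 = d - 1"
        "r'' 17 = n * n + Suc j"
        "r'' 18 > 0 \<longleftrightarrow> r' 18 > 0 \<or> ?A v j \<and> X j < half n" for r''
      using that flag unfolding J_def by (auto simp: less_Suc_eq d_def)
    show "wp scan_body (\<lambda>t s'. t \<le> 10 \<and> (\<exists>j\<le>n. J j (fst s') \<and> snd s' = mem (n * n) m0 X) \<and>
        fst s' 16 < fst s 16) s"
      using row' d j entry_less[OF v j] unfolding s
      by (auto simp: scan_body_def reg adj_def intro!: exI[of _ "Suc j"] step)
  next
    fix t and s' :: state
    assume "\<exists>j\<le>n. J j (fst s') \<and> snd s' = mem (n * n) m0 X" "fst s' 16 = 0"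
      and t: "t \<le> fst (r, mem (n * n) m0 X) 16 * (10 + 1) + 1"
    then have "J n (fst s')" "snd s' = mem (n * n) m0 X"
      by (auto simp: J_def)
    then show "t \<le> 11 * n + 1 \<and> row_inv n m0 k c v (fst s') \<and> fst s' 15 = v * n + n \<and>
        snd s' = mem (n * n) m0 X \<and> (fst s' 18 > 0 \<longleftrightarrow> has_outer n ?A X v)"
      using t r by (auto simp: J_def has_outer_def)
  qed
qed

lemma shrink:
  assumes env: "env n k r"
  shows "wp shrink (\<lambda>t s'. t \<le> n * (11 * n + 21) + 10 \<and> env n k (fst s') \<and>
    snd s' = mem (n * n) m0 (shrunk n (adj n m0) X n)) (r, mem (n * n) m0 X)"
proof -
  let ?A = "adj n m0" and ?c = "r 11"
  define J where "J v r \<longleftrightarrow> row_inv n m0 k ?c v r \<and> r 15 = v * n" for v r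
  have reg: "r 2 = n" "r 3 = n * n" using env by (auto simp: env_def)
  have loop: "wp (While_Pos 12 shrink_body) (\<lambda>t s'. t \<le> n * (11 * n + 21) + 1 \<and>
      env n k (fst s') \<and> snd s' = mem (n * n) m0 (shrunk n ?A X n)) (r', mem (n * n) m0 X)"
    if J0: "J 0 r'" for r'
  proof (rule wp_While[where T = "11 * n + 20" and \<mu> = "\<lambda>s. fst s 12"
        and Inv = "\<lambda>s. \<exists>v\<le>n. J v (fst s) \<and> snd s = mem (n * n) m0 (shrunk n ?A X v)"])
    show "\<exists>v\<le>n. J v (fst (r', mem (n * n) m0 X)) \<and>
        snd (r', mem (n * n) m0 X) = mem (n * n) m0 (shrunk n ?A X v)"
      using J0 by (intro exI[of _ 0]) simp
  next
    fix s :: state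
    assume "\<exists>v\<le>n. J v (fst s) \<and> snd s = mem (n * n) m0 (shrunk n ?A X v)" "0 < fst s 12"
    then obtain v r1 where s: "s = (r1, mem (n * n) m0 (shrunk n ?A X v))" and J: "J v r1"
        and "v \<le> n" "0 < r1 12"
      by (cases s) auto
    then have v: "v < n" unfolding J_def row_inv_def by linarith
    let ?X = "shrunk n ?A X v"
    have row: "row_inv n m0 k ?c v r1" and reg1: "r1 15 = v * n" "r1 2 = n" "r1 3 = n * n"
        "r1 12 = n - v"
      using J by (auto simp: J_def row_inv_def env_def)
    have finish: "wp (If_Pos 18 skip (Const 20 0 ;; Store 13 20) ;; Add 13 13 4 ;; Sub 12 12 4)
        (\<lambda>t s'. t \<le> 5 \<and> (\<exists>v\<le>n. J v (fst s') \<and> snd s' = mem (n * n) m0 (shrunk n ?A X v)) \<and>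
          fst s' 12 < r1 12) (r2, mem (n * n) m0 ?X)"
      if "row_inv n m0 k ?c v r2" "r2 15 = v * n + n" "r2 18 > 0 \<longleftrightarrow> has_outer n ?A ?X v" for r2
    proof -
      have r2: "r2 4 = 1" "r2 12 = n - v" "r2 13 = n * n + v"
        using that(1) by (auto simp: row_inv_def env_def)
      \<comment> \<open>The register \<open>i\<close> is the one cleared by the branch taken: 22 if
        the vertex is kept, 20 if it is removed.\<close>
      have J': "J (Suc v) (r2(i := 0, 13 := Suc (n * n + v), 12 := n - Suc v))"
        if "i = 20 \<or> i = 22" for i
        using \<open>row_inv n m0 k ?c v r2\<close> \<open>r2 15 = _\<close> that by (auto simp: J_def row_inv_def)
      have step: "\<exists>w\<le>n. J w r3 \<and> mem (n * n) m0 (shrunk n ?A X (Suc v)) = mem (n * n) m0 (shrunk n ?A X w)"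
        if "J (Suc v) r3" for r3
        using that v Suc_leI by blast
      show ?thesis
      proof (cases "has_outer n ?A ?X v")
        case True
        have "shrunk n ?A X (Suc v) = ?X" using True by simp
        with step[OF J'[of 22]] show ?thesis
          using that(3) True v by (simp add: r2 reg1 del: shrunk.simps)
      next
        case False
        have "shrunk n ?A X (Suc v) = ?X(v := 0)" using False by simp
        with step[OF J'[of 20]] show ?thesis
          using that(3) False v by (simp add: r2 reg1 del: shrunk.simps)
      qed
    qed
    have main: "wp (While_Pos 16 scan_body ;;
          If_Pos 18 skip (Const 20 0 ;; Store 13 20) ;; Add 13 13 4 ;; Sub 12 12 4)
        (\<lambda>t s'. t \<le> 11 * n + 10 \<and>
          (\<exists>v\<le>n. J v (fst s') \<and> snd s' = mem (n * n) m0 (shrunk n ?A X v)) \<and>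
          fst s' 12 < r1 12) (r2, mem (n * n) m0 ?X)"
      if r2: "row_inv n m0 k ?c v r2" "r2 15 = v * n" "r2 16 = n" "r2 17 = n * n" "r2 18 = 0" for r2
      unfolding wp_Seq[of "While_Pos 16 scan_body"]
    proof (rule wp_mono[OF scan_loop[OF r2(1) v r2(2-5)]])
      fix t :: nat and r3 m
      assume 3: "t \<le> 11 * n + 1 \<and> row_inv n m0 k ?c v (fst (r3, m)) \<and>
        fst (r3, m) 15 = v * n + n \<and> snd (r3, m) = mem (n * n) m0 ?X \<and>
        (fst (r3, m) 18 > 0 \<longleftrightarrow> has_outer n ?A ?X v)"
      then have m: "m = mem (n * n) m0 ?X" by simp
      show "wp (If_Pos 18 skip (Const 20 0 ;; Store 13 20) ;; Add 13 13 4 ;; Sub 12 12 4)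
        (\<lambda>t'. (\<lambda>t s'. t \<le> 11 * n + 10 \<and>
          (\<exists>v\<le>n. J v (fst s') \<and> snd s' = mem (n * n) m0 (shrunk n ?A X v)) \<and>
          fst s' 12 < r1 12) (t + t')) (r3, m)"
        unfolding m by (rule wp_mono[OF finish]) (use 3 in auto)
    qed
    show "wp shrink_body (\<lambda>t s'. t \<le> 11 * n + 20 \<and>
        (\<exists>v\<le>n. J v (fst s') \<and> snd s' = mem (n * n) m0 (shrunk n ?A X v)) \<and>
        fst s' 12 < fst s 12) s"
      unfolding shrink_body_def s
      by (simp del: wp_Seq add: wp_Seq[of "Const _ _"] wp_Seq[of "Add _ _ _"] reg1)
        (rule wp_mono[OF main], use row reg1 in auto)
  next
    fix t and s' :: state
    assume "\<exists>v\<le>n. J v (fst s') \<and> snd s' = mem (n * n) m0 (shrunk n ?A X v)" "fst s' 12 = 0"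
      and t: "t \<le> fst (r', mem (n * n) m0 X) 12 * (11 * n + 20 + 1) + 1"
    moreover have "r' 12 = n" using J0 by (simp add: J_def row_inv_def)
    then have "t \<le> n * (11 * n + 21) + 1" using t by (simp add: add.commute)
    ultimately show "t \<le> n * (11 * n + 21) + 1 \<and> env n k (fst s') \<and>
        snd s' = mem (n * n) m0 (shrunk n ?A X n)"
      by (auto simp: J_def row_inv_def)
  qed
  have start: "J 0 r'"
    if "env n k r'" "r' 11 = ?c" "r' 12 = n" "r' 13 = n * n" "r' 15 = 0" for r'
    using that by (auto simp: J_def row_inv_def)
  show ?thesis
    unfolding shrink_def
    by (simp add: reg) (rule wp_mono[OF loop[OF start]], use env in auto)
qed

section \<open>Writing the characteristic vector of the cover\<close>

lemma copy_out:
  assumes env: "env n k r"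
  shows "wp copy_out (\<lambda>t s'. t \<le> 8 * n + 10 \<and>
    output_bits s' = map (\<lambda>a. half n \<le> X a) [0..<n]) (r, mem (n * n) m0 X)"
proof -
  define J where "J j r m \<longleftrightarrow> env n k r \<and> r 13 = j \<and> r 16 = n - j \<and> r 17 = n * n + j \<and>
    (\<exists>m1. m = mem (n * n) m1 X \<and> (\<forall>a<j. m1 a > 0 \<longleftrightarrow> half n \<le> X a))" for j r m
  have reg: "r 2 = n" "r 3 = n * n" using env by (auto simp: env_def)
  have loop: "wp (While_Pos 16 copy_body) (\<lambda>t s'. t \<le> 8 * n + 1 \<and>
      J n (fst s') (snd s')) (r', mem (n * n) m0 X)"
    if J0: "J 0 r' (mem (n * n) m0 X)" for r'
  proof (rule wp_While[where T = 7 and \<mu> = "\<lambda>s. fst s 16"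
        and Inv = "\<lambda>s. \<exists>j\<le>n. J j (fst s) (snd s)"])
    show "\<exists>j\<le>n. J j (fst (r', mem (n * n) m0 X)) (snd (r', mem (n * n) m0 X))"
      using J0 by (intro exI[of _ 0]) simp
  next
    fix s :: state
    assume "\<exists>j\<le>n. J j (fst s) (snd s)" "0 < fst s 16"
    then obtain j r1 m where "s = (r1, m)" and J: "J j r1 m" and "j \<le> n" "0 < r1 16"
      by (cases s) auto
    then obtain m1 where s: "s = (r1, mem (n * n) m1 X)" and j: "j < n"
        and m1: "\<forall>a<j. m1 a > 0 \<longleftrightarrow> half n \<le> X a"
      unfolding J_def by auto
    have reg1: "r1 4 = 1" "r1 5 = half n" "r1 13 = j" "r1 16 = n - j" "r1 17 = n * n + j"
        and env1: "env n k r1"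
      using J by (auto simp: J_def env_def)
    \<comment> \<open>The output fits into the space of the matrix and never touches the array
      \<open>X\<close> that is still being read.\<close>
    have "j < n * n" using j by (metis le_square less_le_trans)
    moreover have "J (Suc j) r2 (mem (n * n) (m1(j := Suc (X j) - half n)) X)"
      if "env n k r2" "r2 13 = Suc j" "r2 16 = n - j - 1" "r2 17 = n * n + Suc j" for r2
      using that m1 unfolding J_def
      by (auto intro!: exI[of _ "m1(j := Suc (X j) - half n)"] simp: less_Suc_eq)
    ultimately show "wp copy_body (\<lambda>t s'. t \<le> 7 \<and> (\<exists>j\<le>n. J j (fst s') (snd s')) \<and>
        fst s' 16 < fst s 16) s"
      using j env1 unfolding s by (auto simp: copy_body_def reg1 intro!: exI[of _ "Suc j"])
  next
    fix t and s' :: state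
    assume "\<exists>j\<le>n. J j (fst s') (snd s')" "fst s' 16 = 0"
      and t: "t \<le> fst (r', mem (n * n) m0 X) 16 * (7 + 1) + 1"
    moreover have "r' 16 = n" using J0 by (simp add: J_def)
    ultimately show "t \<le> 8 * n + 1 \<and> J n (fst s') (snd s')"
      by (auto simp: J_def)
  qed
  have start: "J 0 r' (mem (n * n) m0 X)"
    if "env n k r'" "r' 13 = 0" "r' 16 = n" "r' 17 = n * n" for r'
    using that by (auto simp: J_def)
  have result: "output_bits (r', m) = map (\<lambda>a. half n \<le> X a) [0..<n]"
    if "J n r'' m" "r' 0 = n" for r' r'' m
  proof -
    have "a < n * n" if "a < n" for a using that by (metis le_square less_le_trans)
    then show ?thesis using that by (auto simp: J_def output_bits_def)
  qed
  have last: "wp (Const 0 0 ;; Add 0 0 2) (\<lambda>t s'. t \<le> 2 \<and>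
      output_bits s' = map (\<lambda>a. half n \<le> X a) [0..<n]) (r', m)" if "J n r' m" for r' m
  proof -
    have "r' 2 = n" using that by (simp add: J_def env_def)
    then show ?thesis using result[OF that] by simp
  qed
  have main: "wp (While_Pos 16 copy_body ;; Const 0 0 ;; Add 0 0 2) (\<lambda>t s'. t \<le> 8 * n + 3 \<and>
      output_bits s' = map (\<lambda>a. half n \<le> X a) [0..<n]) (r', mem (n * n) m0 X)"
    if "J 0 r' (mem (n * n) m0 X)" for r'
    unfolding wp_Seq[of "While_Pos 16 copy_body"]
  proof (rule wp_mono[OF loop[OF that]])
    fix t :: nat and r1 m
    assume 1: "t \<le> 8 * n + 1 \<and> J n (fst (r1, m)) (snd (r1, m))"
    then have "J n r1 m" by simp
    from last[OF this] show "wp (Const 0 0 ;; Add 0 0 2) (\<lambda>t'. (\<lambda>t s'. t \<le> 8 * n + 3 \<and>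
        output_bits s' = map (\<lambda>a. half n \<le> X a) [0..<n]) (t + t')) (r1, m)"
      by (rule wp_mono) (use 1 in auto)
  qed
  show ?thesis
    unfolding copy_out_def
    by (simp del: wp_Seq add: wp_Seq[of "Const _ _"] wp_Seq[of "Add _ _ _"] reg)
      (rule wp_mono[OF main[OF start]], use env in auto)
qed

section \<open>Computing \<open>n\<close> and the constants without multiplication\<close>

lemma add_loop:
  assumes "r 4 = 1" and ij: "i \<noteq> j" "i \<noteq> 16" "i \<noteq> 4" "j \<noteq> 16" "j \<noteq> 4"
  shows "wp (While_Pos 16 (add_body i j))
    (\<lambda>t s'. t \<le> 3 * r 16 + 1 \<and> s' = (r(i := r i + r 16 * r j, 16 := 0), m)) (r, m)"
proof (rule wp_While[where T = 2 and \<mu> = "\<lambda>s. fst s 16"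
      and Inv = "\<lambda>s. \<exists>a b. a + b = r 16 \<and> s = (r(i := r i + a * r j, 16 := b), m)"])
  \<comment> \<open>In the invariant, \<open>a\<close> additions have been done and \<open>b\<close>
    are still to come.\<close>
  show "\<exists>a b. a + b = r 16 \<and> (r, m) = (r(i := r i + a * r j, 16 := b), m)"
    by (intro exI[of _ 0] exI[of _ "r 16"]) simp
next
  fix s :: state
  assume "\<exists>a b. a + b = r 16 \<and> s = (r(i := r i + a * r j, 16 := b), m)" "0 < fst s 16"
  then obtain a b where ab: "a + Suc b = r 16" and s: "s = (r(i := r i + a * r j, 16 := Suc b), m)"
    by (auto simp: gr0_conv_Suc)
  have "r(i := r i + a * r j, 16 := Suc b, i := r i + a * r j + r j, 16 := b)
      = r(i := r i + Suc a * r j, 16 := b)"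
    using ij by (auto simp: fun_eq_iff)
  then have "Suc a + b = r 16 \<and>
      (r(i := r i + a * r j, 16 := Suc b, i := r i + a * r j + r j, 16 := b), m)
      = (r(i := r i + Suc a * r j, 16 := b), m)"
    using ab by simp
  then have "\<exists>a' b'. a' + b' = r 16 \<and>
      (r(i := r i + a * r j, 16 := Suc b, i := r i + a * r j + r j, 16 := b), m)
      = (r(i := r i + a' * r j, 16 := b'), m)"
    by blast
  then show "wp (add_body i j) (\<lambda>t s'. t \<le> 2 \<and>
      (\<exists>a b. a + b = r 16 \<and> s' = (r(i := r i + a * r j, 16 := b), m)) \<and> fst s' 16 < fst s 16) s"
    using assms unfolding s by (simp add: add_body_def)
next
  fix t and s' :: state
  assume "\<exists>a b. a + b = r 16 \<and> s' = (r(i := r i + a * r j, 16 := b), m)" "fst s' 16 = 0"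
    "t \<le> fst (r, m) 16 * (2 + 1) + 1"
  then show "t \<le> 3 * r 16 + 1 \<and> s' = (r(i := r i + r 16 * r j, 16 := 0), m)"
    by auto
qed

text \<open>The input gives only its length, so \<open>n\<close> is found as the least number whose
  square reaches it, the square being updated by \<open>n + n + 1\<close>. Inputs of non-square
  length are handled as well.\<close>

lemma root:
  fixes x :: "bool list"
  defines "m \<equiv> snd (input_state x)"
  shows "wp (Const 4 1 ;; Sub 22 0 3 ;; While_Pos 22 root_body)
    (\<lambda>t s'. t \<le> 6 * length x + 3 \<and> snd s' = m \<and>
      (\<exists>n. fst s' 2 = n \<and> fst s' 3 = n * n \<and> fst s' 4 = 1 \<and> n \<le> length x \<and>
        length x \<le> n * n \<and> (n > 0 \<longrightarrow> (n - 1) * (n - 1) < length x))) (input_state x)"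
proof -
  let ?L = "length x"
  define J where "J r n \<longleftrightarrow> r 0 = ?L \<and> r 2 = n \<and> r 3 = n * n \<and> r 4 = 1 \<and> r 22 = ?L - n * n \<and>
    n \<le> ?L \<and> (n > 0 \<longrightarrow> (n - 1) * (n - 1) < ?L)" for r :: "nat \<Rightarrow> nat" and n
  have loop: "wp (While_Pos 22 root_body)
      (\<lambda>t s'. t \<le> 6 * ?L + 1 \<and> snd s' = m \<and> (\<exists>n. J (fst s') n \<and> ?L \<le> n * n)) (r, m)"
    if J0: "J r 0" for r
  proof (rule wp_While[where T = 5 and \<mu> = "\<lambda>s. fst s 22"
        and Inv = "\<lambda>s. snd s = m \<and> (\<exists>n. J (fst s) n)"])
    show "snd (r, m) = m \<and> (\<exists>n. J (fst (r, m)) n)" using J0 by auto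
  next
    fix s :: state
    assume "snd s = m \<and> (\<exists>n. J (fst s) n)" "0 < fst s 22"
    then obtain r n where s: "s = (r, m)" and J: "J r n" and pos: "0 < r 22"
      by (cases s) auto
    have sq: "n * n < ?L" using J pos by (simp add: J_def)
    have "n < ?L" using sq by (metis le_square le_less_trans)
    then have "J (r(3 := Suc (n * n + n + n), 2 := Suc n, 22 := ?L - Suc (n * n + n + n))) (Suc n)"
      using J sq by (simp add: J_def)
    then show "wp root_body (\<lambda>t s'. t \<le> 5 \<and> (snd s' = m \<and> (\<exists>n. J (fst s') n)) \<and>
        fst s' 22 < fst s 22) s"
      using J sq unfolding s by (auto simp: root_body_def J_def)
  next
    fix t and s' :: state
    assume "snd s' = m \<and> (\<exists>n. J (fst s') n)" "fst s' 22 = 0" "t \<le> fst (r, m) 22 * (5 + 1) + 1"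
    moreover have "r 22 = ?L" using J0 by (simp add: J_def)
    ultimately show "t \<le> 6 * ?L + 1 \<and> snd s' = m \<and> (\<exists>n. J (fst s') n \<and> ?L \<le> n * n)"
      by (auto simp: J_def)
  qed
  define r0 :: "nat \<Rightarrow> nat" where "r0 = (\<lambda>i. if i = 0 then ?L else 0)"
  have input: "input_state x = (r0, m)"
    by (simp add: input_state_def r0_def m_def)
  have "J (r0(4 := 1, 22 := ?L)) 0"
    by (simp add: J_def r0_def)
  note main = loop[OF this]
  show ?thesis
    unfolding input by (simp add: r0_def) (rule wp_mono[OF main[unfolded r0_def One_nat_def]], auto simp: J_def)
qed

text \<open>Two loops of additions compute the budget: \<open>full n\<close> summed
  \<open>full n\<close> times, and then that square summed \<open>n\<close> times onto 1. Register
  10 starts at \<open>n\<close> because \<open>k - 1 = 0\<close>.\<close>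

lemma init:
  assumes r: "r 2 = n" "r 3 = n * n" "r 4 = 1"
  shows "wp init (\<lambda>t s'. t \<le> 27 * n + 40 \<and> search_inv n m0 1 (\<lambda>_. 0) (fst s') \<and>
    fst s' 11 = Suc (n * full n * full n) \<and> snd s' = m) (r, m)"
proof -
  have full: "Suc (Suc (n + n + (n + n) + (n + n + (n + n)))) = full n"
    by (simp add: full_def half_def)
  have inv: "search_inv n m0 (Suc 0) (\<lambda>_. 0) r'"
    if "env n 1 r'" "r' 11 = Suc (n * full n * full n)" "r' 14 = 1" for r'
  proof -
    have "potential n H (\<lambda>_. 0) < int (Suc (n * full n * full n))" for H
      using potential_le[of n "\<lambda>_. 0" H] by simp
    then show ?thesis using that by (simp add: search_inv_def)
  qed
  let ?r1 = "r(5 := n + n + (n + n), 6 := n + n + (n + n) + (n + n + (n + n)), 7 := full n,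
      20 := 0, 16 := full n)"
  let ?r2 = "r(5 := n + n + (n + n), 6 := n + n + (n + n) + (n + n + (n + n)), 7 := full n,
      20 := full n * full n, 8 := 1, 16 := n)"
  have post: "wp (Const 9 1 ;; Const 10 0 ;; Add 10 10 2 ;; Const 11 0 ;; Add 11 11 8 ;; Const 14 1)
      (\<lambda>t s'. t \<le> 6 \<and> search_inv n m0 1 (\<lambda>_. 0) (fst s') \<and>
        fst s' 11 = Suc (n * full n * full n) \<and> snd s' = m)
      (?r2(8 := Suc (n * (full n * full n)), 16 := 0), m)"
    using r by (simp add: inv env_def half_def mult.assoc)
  have second: "wp (While_Pos 16 (add_body 8 20) ;;
        Const 9 1 ;; Const 10 0 ;; Add 10 10 2 ;; Const 11 0 ;; Add 11 11 8 ;; Const 14 1)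
      (\<lambda>t s'. t \<le> 3 * n + 7 \<and> search_inv n m0 1 (\<lambda>_. 0) (fst s') \<and>
        fst s' 11 = Suc (n * full n * full n) \<and> snd s' = m) (?r2, m)"
    unfolding wp_Seq[of "While_Pos 16 (add_body 8 20)"]
  proof (rule wp_mono[OF add_loop])
    fix t r' m'
    assume "t \<le> 3 * ?r2 16 + 1 \<and> (r', m') = (?r2(8 := ?r2 8 + ?r2 16 * ?r2 20, 16 := 0), m)"
    then have t: "t \<le> 3 * n + 1" and r': "r' = ?r2(8 := Suc (n * (full n * full n)), 16 := 0)"
      and m': "m' = m"
      by auto
    show "wp (Const 9 1 ;; Const 10 0 ;; Add 10 10 2 ;; Const 11 0 ;; Add 11 11 8 ;; Const 14 1)
      (\<lambda>t'. (\<lambda>t s'. t \<le> 3 * n + 7 \<and> search_inv n m0 1 (\<lambda>_. 0) (fst s') \<and>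
        fst s' 11 = Suc (n * full n * full n) \<and> snd s' = m) (t + t')) (r', m')"
      unfolding r' m' by (rule wp_mono[OF post]) (use t in auto)
  qed (use r in auto)
  let ?rest = "Const 9 1 ;; Const 10 0 ;; Add 10 10 2 ;; Const 11 0 ;; Add 11 11 8 ;; Const 14 1"
  have first: "wp (While_Pos 16 (add_body 20 7) ;;
        Const 8 1 ;; Const 16 0 ;; Add 16 16 2 ;; While_Pos 16 (add_body 8 20) ;; ?rest)
      (\<lambda>t s'. t \<le> 27 * n + 20 \<and> search_inv n m0 1 (\<lambda>_. 0) (fst s') \<and>
        fst s' 11 = Suc (n * full n * full n) \<and> snd s' = m) (?r1, m)"
    unfolding wp_Seq[of "While_Pos 16 (add_body 20 7)"]
  proof (rule wp_mono[OF add_loop])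
    fix t r' m'
    assume 1: "t \<le> 3 * ?r1 16 + 1 \<and> (r', m') = (?r1(20 := ?r1 20 + ?r1 16 * ?r1 7, 16 := 0), m)"
    then have t: "t \<le> 24 * n + 7" by (simp add: full_def half_def)
    have r': "r'(8 := 1, 16 := n) = ?r2" and r'2: "r' 2 = n" and m': "m' = m"
      using 1 r by (auto simp: fun_eq_iff)
    show "wp (Const 8 1 ;; Const 16 0 ;; Add 16 16 2 ;; While_Pos 16 (add_body 8 20) ;; ?rest)
      (\<lambda>t'. (\<lambda>t s'. t \<le> 27 * n + 20 \<and> search_inv n m0 1 (\<lambda>_. 0) (fst s') \<and>
        fst s' 11 = Suc (n * full n * full n) \<and> snd s' = m) (t + t')) (r', m')"
      using r' r'2 unfolding m'
      by (simp del: wp_Seq add: wp_Seq[of "Const _ _"] wp_Seq[of "Add _ _ _"])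
        (rule wp_mono[OF second[unfolded One_nat_def]], use t in auto)
  qed (use r in auto)
  show ?thesis
    unfolding init_def
    by (simp del: wp_Seq add: wp_Seq[of "Const _ _"] wp_Seq[of "Add _ _ _"] r full)
      (rule wp_mono[OF first[unfolded One_nat_def]], auto)
qed

section \<open>The whole program and its running time\<close>

definition vc_time :: "nat \<Rightarrow> nat" where
  "vc_time l = (6 * l + 3) + (27 * l + 40) +
     (Suc l * Suc (l * full l * full l) * (l * (32 * l + 61) + 21) + 1) +
     (l * (11 * l + 21) + 10) + (8 * l + 10)"

text \<open>Stated for every bit string, as polynomial time requires: the matrix may have loops or
  be asymmetric, and missing entries count as 0. Graphs enter only later.\<close>

definition vc_output :: "bool list \<Rightarrow> bool list \<Rightarrow> bool" where
  "vc_output x y \<longleftrightarrow> (\<exists>n X k. let A = adj n (snd (input_state x)) in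
     n \<le> length x \<and> length x \<le> n * n \<and> (n > 0 \<longrightarrow> (n - 1) * (n - 1) < length x) \<and>
     1 \<le> k \<and> (\<forall>v<n. settled n A k X v) \<and>
     (\<forall>k' H. 1 \<le> k' \<longrightarrow> feasible n A k' H \<longrightarrow> k \<le> k') \<and>
     y = map (\<lambda>a. half n \<le> shrunk n A X n a) [0..<n])"

lemma full_mono: "n \<le> l \<Longrightarrow> full n \<le> full l"
  by (simp add: full_def half_def)

lemma fair_vc_prog:
  "wp fair_vc_prog (\<lambda>t s. t \<le> vc_time (length x) \<and> vc_output x (output_bits s)) (input_state x)"
  unfolding fair_vc_prog_def wp_Seq[of "Const 4 1 ;; _"]
proof (rule wp_mono[OF root])
  let ?m = "snd (input_state x)" and ?l = "length x"
  fix t1 :: nat and r1 m1 :: "nat \<Rightarrow> nat"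
  assume "t1 \<le> 6 * ?l + 3 \<and> snd (r1, m1) = ?m \<and>
    (\<exists>n. fst (r1, m1) 2 = n \<and> fst (r1, m1) 3 = n * n \<and> fst (r1, m1) 4 = 1 \<and> n \<le> ?l \<and>
      ?l \<le> n * n \<and> (n > 0 \<longrightarrow> (n - 1) * (n - 1) < ?l))"
  then obtain n where t1: "t1 \<le> 6 * ?l + 3" and m1: "m1 = ?m"
      and r1: "r1 2 = n" "r1 3 = n * n" "r1 4 = 1"
      and n: "n \<le> ?l" "?l \<le> n * n" "n > 0 \<longrightarrow> (n - 1) * (n - 1) < ?l"
    by auto
  \<comment> \<open>Cells beyond the input are 0 and the input ends before \<open>n * n\<close>, so
    the array starts at 0 without being initialised.\<close>
  have zero: "?m = mem (n * n) ?m (\<lambda>_. 0)"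
    using n(2) by (auto simp: mem_def input_state_def fun_eq_iff)
  let ?A = "adj n ?m"
  let ?search_time = "Suc n * Suc (n * full n * full n) * (n * (32 * n + 61) + 21) + 1"
  have out: "wp copy_out (\<lambda>t s. t \<le> 8 * n + 10 \<and> vc_output x (output_bits s))
      (r, mem (n * n) ?m (shrunk n ?A X n))"
    if "search_inv n ?m k X r0" "r0 14 = 0" "env n k r" for r0 r X k
    by (rule wp_mono[OF copy_out[OF that(3)]])
      (use that n in \<open>auto simp: vc_output_def search_inv_def Let_def\<close>)
  have tail: "wp (shrink ;; copy_out)
      (\<lambda>t s. t \<le> (n * (11 * n + 21) + 10) + (8 * n + 10) \<and> vc_output x (output_bits s))
      (r, mem (n * n) ?m X)"
    if "search_inv n ?m k X r" "r 14 = 0" for r X k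
    unfolding wp_Seq
  proof (rule wp_mono[OF shrink[of n k]])
    fix t :: nat and r' m'
    assume 1: "t \<le> n * (11 * n + 21) + 10 \<and> env n k (fst (r', m')) \<and>
      snd (r', m') = mem (n * n) ?m (shrunk n ?A X n)"
    then have m': "m' = mem (n * n) ?m (shrunk n ?A X n)" and "env n k r'" by auto
    then show "wp copy_out (\<lambda>t'. (\<lambda>t s. t \<le> (n * (11 * n + 21) + 10) + (8 * n + 10) \<and>
        vc_output x (output_bits s)) (t + t')) (r', m')"
      unfolding m' by (intro wp_mono[OF out[OF that]]) (use 1 in auto)
  qed (use that in \<open>simp add: search_inv_def\<close>)
  have search': "wp (While_Pos 14 search_body ;; shrink ;; copy_out)
      (\<lambda>t s. t \<le> ?search_time + (n * (11 * n + 21) + 10) + (8 * n + 10) \<and>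
        vc_output x (output_bits s)) (r, mem (n * n) ?m (\<lambda>_. 0))"
    if "search_inv n ?m 1 (\<lambda>_. 0) r" "r 11 = Suc (n * full n * full n)" for r
    unfolding wp_Seq[of "While_Pos 14 search_body"]
  proof (rule wp_mono[OF search[OF that]])
    fix t :: nat and r' m'
    assume 1: "t \<le> ?search_time \<and>
      (\<exists>X k. search_inv n ?m k X (fst (r', m')) \<and> fst (r', m') 14 = 0 \<and>
         snd (r', m') = mem (n * n) ?m X)"
    then obtain X k where X: "search_inv n ?m k X r'" "r' 14 = 0" and m': "m' = mem (n * n) ?m X"
      by auto
    show "wp (shrink ;; copy_out) (\<lambda>t'. (\<lambda>t s.
        t \<le> ?search_time + (n * (11 * n + 21) + 10) + (8 * n + 10) \<and>
        vc_output x (output_bits s)) (t + t')) (r', m')"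
      unfolding m' by (rule wp_mono[OF tail[OF X]]) (use 1 in auto)
  qed
  \<comment> \<open>All phase bounds are monotone in \<open>n\<close>, and \<open>n\<close> is at
    most the input length.\<close>
  have time: "(6 * ?l + 3) + (27 * n + 40) + ?search_time + (n * (11 * n + 21) + 10) + (8 * n + 10)
      \<le> vc_time ?l"
    unfolding vc_time_def
    by (intro add_mono mult_mono full_mono n(1) le_refl zero_le Suc_leI le_imp_less_Suc)
  show "wp (init ;; While_Pos 14 search_body ;; shrink ;; copy_out)
      (\<lambda>t'. (\<lambda>t s. t \<le> vc_time ?l \<and> vc_output x (output_bits s)) (t1 + t')) (r1, m1)"
    unfolding wp_Seq[of init] m1
  proof (rule wp_mono[OF init[OF r1]])
    fix t :: nat and r' m'
    assume 1: "t \<le> 27 * n + 40 \<and> search_inv n ?m 1 (\<lambda>_. 0) (fst (r', m')) \<and>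
      fst (r', m') 11 = Suc (n * full n * full n) \<and> snd (r', m') = ?m"
    then have m': "m' = mem (n * n) ?m (\<lambda>_. 0)" using zero by simp
    have r': "search_inv n ?m 1 (\<lambda>_. 0) r'" "r' 11 = Suc (n * full n * full n)" using 1 by auto
    show "wp (While_Pos 14 search_body ;; shrink ;; copy_out)
        (\<lambda>t'. (\<lambda>t'. (\<lambda>t s. t \<le> vc_time ?l \<and> vc_output x (output_bits s)) (t1 + t')) (t + t'))
        (r', m')"
      unfolding m' by (rule wp_mono[OF search'[OF r']]) (use 1 t1 time in linarith)
  qed
qed

section \<open>The approximation guarantee\<close>

lemma sparseness_le:
  fixes n :: nat
  assumes "\<And>v. v < n \<Longrightarrow> card (H \<inter> closed_nbhd E v) \<le> b"
  shows "sparseness {..<n} E H \<le> b"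
proof (cases "n = 0")
  case False
  then show ?thesis unfolding sparseness_def by (intro cSUP_least) (auto intro: assms)
\<comment> \<open>Without vertices, the supremum is that of the empty set of naturals, which is
  0.\<close>
qed (simp add: sparseness_def Sup_nat_def)

lemma le_sparseness:
  fixes n :: nat
  assumes "v < n"
  shows "card (H \<inter> closed_nbhd E v) \<le> sparseness {..<n} E H"
  unfolding sparseness_def using assms by (intro cSUP_upper) auto

lemma closed_nbhd_eq:
  fixes n :: nat
  assumes "simple_graph {..<n} E" "v < n" "\<And>u. u < n \<Longrightarrow> A v u \<longleftrightarrow> {v, u} \<in> E"
  shows "closed_nbhd E v = insert v (nbrs n A v)"
proof -
  have "u < n" if "{u, v} \<in> E" for u using assms(1) that by (auto simp: simple_graph_def)
  then show ?thesis
    using assms(3) by (auto simp: closed_nbhd_def nbrs_def insert_commute)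
qed

lemma graph_irrefl: "simple_graph V E \<Longrightarrow> {v, v} \<notin> E"
  by (auto simp: simple_graph_def)

text \<open>A vertex outside \<open>H\<close> has all its neighbours in \<open>H\<close>, more than
  \<open>k\<close> if it is big. A big vertex is therefore in \<open>H\<close>, where it counts
  itself and leaves room for \<open>k - 1\<close> neighbours.\<close>

lemma cover_feasible:
  assumes G: "simple_graph {..<n} E" and A: "\<And>v u. v < n \<Longrightarrow> u < n \<Longrightarrow> A v u \<longleftrightarrow> {v, u} \<in> E"
    and H: "vertex_cover {..<n} E H" "sparseness {..<n} E H \<le> k"
  shows "feasible n A k H"
  unfolding feasible_def
proof (intro conjI allI impI)
  fix v u assume "v < n" "u < n" "A v u"
  then show "u \<in> H \<or> v \<in> H" using A H(1) by (fastforce simp: vertex_cover_def)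
next
  fix v assume v: "v < n" and k: "k < card (nbrs n A v)"
  have fin: "finite H" using H(1) finite_subset by (auto simp: vertex_cover_def)
  have le: "card (H \<inter> insert v (nbrs n A v)) \<le> k"
    using le_sparseness[OF v, of H E] H(2) closed_nbhd_eq[of n E v A] G A v by simp
  show vH: "v \<in> H"
  proof (rule ccontr)
    assume "v \<notin> H"
    then have "nbrs n A v \<subseteq> H \<inter> insert v (nbrs n A v)"
      using A v H(1) by (fastforce simp: vertex_cover_def nbrs_def)
    then have "card (nbrs n A v) \<le> card (H \<inter> insert v (nbrs n A v))"
      using fin by (intro card_mono) auto
    with le k show False by linarith
  qed
  have "v \<notin> nbrs n A v" using A[OF v v] graph_irrefl[OF G, of v] by (simp add: nbrs_def)
  then have "card (H \<inter> insert v (nbrs n A v)) = Suc (card (H \<inter> nbrs n A v))"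
    using vH by simp
  with le show "card (H \<inter> nbrs n A v) \<le> k - 1" by simp
qed

text \<open>The minimum is attained because there are finitely many covers, the set of all vertices
  being one.\<close>

lemma opt_sparseness_cover:
  fixes n :: nat
  assumes "simple_graph {..<n} E"
  obtains H where "vertex_cover {..<n} E H" "sparseness {..<n} E H = opt_sparseness {..<n} E"
proof -
  have "vertex_cover {..<n} E {..<n}"
    using assms by (fastforce simp: vertex_cover_def simple_graph_def card_2_iff)
  moreover have "finite {H. vertex_cover {..<n} E H}"
    by (rule finite_subset[of _ "Pow {..<n}"]) (auto simp: vertex_cover_def)
  ultimately have "opt_sparseness {..<n} E \<in> sparseness {..<n} E ` {H. vertex_cover {..<n} E H}"
    unfolding opt_sparseness_def by (intro Min_in) auto
  then show ?thesis using that by auto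
qed

lemma vc_output_encode_graph:
  assumes G: "simple_graph {..<n} E" and out: "vc_output (encode_graph n E) y"
  defines "k \<equiv> opt_sparseness {..<n} E"
  shows "\<exists>W. y = encode_set n W \<and> vertex_cover {..<n} E W \<and>
    (k > 0 \<longrightarrow> sparseness {..<n} E W \<le> 2 * k - 1) \<and> (k = 0 \<longrightarrow> sparseness {..<n} E W = 0)"
proof -
  let ?x = "encode_graph n E"
  obtain n' X j where n': "n * n \<le> n' * n'" "n' > 0 \<longrightarrow> (n' - 1) * (n' - 1) < n * n"
      and "let A = adj n' (snd (input_state ?x)) in 1 \<le> j \<and> (\<forall>v<n'. settled n' A j X v) \<and>
        (\<forall>k' H. 1 \<le> k' \<longrightarrow> feasible n' A k' H \<longrightarrow> j \<le> k') \<and>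
        y = map (\<lambda>a. half n' \<le> shrunk n' A X n' a) [0..<n']"
    using out by (auto simp: vc_output_def Let_def encode_graph_def)
  \<comment> \<open>The computed root is exact: \<open>(n' - 1)^2 < n^2\<close> and
    \<open>n^2 \<le> n'^2\<close>.\<close>
  moreover have "n' = n"
  proof -
    have "n \<le> n'" using n'(1) by (meson mult_strict_mono' not_le zero_le)
    moreover have "n' - 1 < n" if "n' > 0"
      using n'(2) that by (meson mult_le_mono not_le)
    ultimately show ?thesis by linarith
  qed
  moreover define A where "A = adj n (snd (input_state ?x))"
  ultimately have j: "1 \<le> j" and set: "\<And>v. v < n \<Longrightarrow> settled n A j X v"
      and least: "\<And>k' H. 1 \<le> k' \<Longrightarrow> feasible n A k' H \<Longrightarrow> j \<le> k'"
      and y: "y = map (\<lambda>a. half n \<le> shrunk n A X n a) [0..<n]"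
    by (auto simp: Let_def)
  have A: "A v u \<longleftrightarrow> {v, u} \<in> E" if "v < n" "u < n" for v u
    using that entry_less[OF that]
    by (simp add: A_def adj_def input_state_def encode_graph_def)
  define W where "W = {u. u < n \<and> half n \<le> shrunk n A X n u}"
  have WX: "W \<subseteq> {u. half n \<le> X u}"
  proof
    fix u assume "u \<in> W"
    then show "u \<in> {u. half n \<le> X u}" using shrunk_le[of n A X n u] by (simp add: W_def)
  qed
  have sym: "\<forall>v<n. \<forall>u<n. A v u \<longrightarrow> A u v \<and> u \<noteq> v"
    using A graph_irrefl[OF G] by (metis insert_commute)
  \<comment> \<open>Two entries with sum at least \<open>2 * half n\<close> cannot both lie below
    \<open>half n\<close>.\<close>
  have "\<forall>v<n. \<forall>u<n. A v u \<longrightarrow> half n \<le> X v \<or> half n \<le> X u"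
    using set by (fastforce simp: settled_def)
  note cov = shrunk_cover[OF sym this le_refl]
  have cover: "vertex_cover {..<n} E W"
    unfolding vertex_cover_def
  proof (intro conjI ballI)
    show "W \<subseteq> {..<n}" by (auto simp: W_def)
    fix e assume e: "e \<in> E"
    then obtain v u where "e = {v, u}" "v < n" "u < n"
      using G by (fastforce simp: simple_graph_def card_2_iff)
    then show "e \<inter> W \<noteq> {}" using cov A e by (auto simp: W_def)
  qed
  have minimal: "\<exists>u<n. A v u \<and> u \<notin> W" if "v \<in> W" for v
    using shrunk_minimal[of n n A X] that by (force simp: W_def has_outer_def)
  obtain H where H: "vertex_cover {..<n} E H" "sparseness {..<n} E H = k"
    using opt_sparseness_cover[OF G] by (auto simp: k_def)
  have "sparseness {..<n} E W \<le> 2 * k - 1" if k: "k > 0"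
  proof (rule sparseness_le)
    \<comment> \<open>An optimal cover is feasible for \<open>k\<close>, so the search has stopped
      at some \<open>j\<close> not above \<open>k\<close>, and the bound \<open>2 * j - 1\<close> is
      good enough.\<close>
    have "j \<le> k" using cover_feasible[OF G A H(1)] H(2) k by (intro least) auto
    fix v assume v: "v < n"
    have "card (W \<inter> insert v (nbrs n A v)) \<le> 2 * j - 1"
    proof (cases "j < card (nbrs n A v)")
      case True
      then show ?thesis using big_vertex_bound[OF set[OF v] v True j WX] by simp
    next
      case False
      then have "card (W \<inter> insert v (nbrs n A v)) \<le> j"
        using small_vertex_bound[OF v _ j, of A W] minimal by simp
      then show ?thesis using j by linarith
    qed
    then show "card (W \<inter> closed_nbhd E v) \<le> 2 * k - 1"
      using closed_nbhd_eq[of n E v A] G A v \<open>j \<le> k\<close> by simp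
  qed
  \<comment> \<open>The search starts at 1, so this case is separate: an optimal cover is empty,
    hence there are no edges, and minimality empties \<open>W\<close>.\<close>
  moreover have "sparseness {..<n} E W = 0" if k: "k = 0"
  proof -
    have "v \<notin> H" if "v < n" for v
    proof
      assume "v \<in> H"
      have "finite H" using H(1) finite_subset by (auto simp: vertex_cover_def)
      then have "finite (H \<inter> closed_nbhd E v)" by simp
      moreover have "card (H \<inter> closed_nbhd E v) = 0"
        using le_sparseness[OF that, of H E] H(2) k by simp
      moreover have "v \<in> H \<inter> closed_nbhd E v" using \<open>v \<in> H\<close> by (simp add: closed_nbhd_def)
      ultimately show False by auto
    qed
    then have "H = {}" using H(1) by (auto simp: vertex_cover_def)
    then have "E = {}" using H(1) by (auto simp: vertex_cover_def)
    then have "W = {}" using minimal A by (auto simp: W_def)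
    then show ?thesis using sparseness_le[of n W E 0] by simp
  qed
  moreover have "y = encode_set n W" by (simp add: y encode_set_def W_def)
  ultimately show ?thesis using cover by blast
qed

section \<open>The computed function and its polynomial time bound\<close>

definition fair_vc :: "bool list \<Rightarrow> bool list" where
  "fair_vc x = output_bits (SOME s. \<exists>t. exec fair_vc_prog (input_state x) t s)"

text \<open>The choice in \<open>fair_vc\<close> is harmless: the program halts on every input, and
  by determinism in only one state.\<close>

lemma fair_vc_exec:
  obtains t s where "exec fair_vc_prog (input_state x) t s" "t \<le> vc_time (length x)"
    "output_bits s = fair_vc x" "vc_output x (fair_vc x)"
proof -
  obtain t s where s: "exec fair_vc_prog (input_state x) t s" "t \<le> vc_time (length x)"
      "vc_output x (output_bits s)"
    using fair_vc_prog[of x] unfolding wp_def by blast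
  then have "(SOME s. \<exists>t. exec fair_vc_prog (input_state x) t s) = s"
    using exec_deterministic by blast
  then show ?thesis using that s by (simp add: fair_vc_def)
qed

lemma polynomial_time_fair_vc: "polynomial_time fair_vc"
proof -
  define l :: "nat poly" where "l = [:0, 1:]"
  define f where "f = 8 * l + 2"
  \<comment> \<open>This is \<open>vc_time\<close> as a polynomial, with a further summand
    \<open>l\<close> for the output, whose length \<open>n\<close> is at most the input
    length.\<close>
  define q where "q = (6 * l + 3) + (27 * l + 40) +
     ((l + 1) * (l * f * f + 1) * (l * (32 * l + 61) + 21) + 1) +
     (l * (11 * l + 21) + 10) + (8 * l + 10) + l"
  have l: "poly l i = i" for i by (simp add: l_def)
  have f: "poly f i = full i" for i by (simp add: f_def l full_def half_def)
  have q: "poly q i = vc_time i + i" for i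
    by (simp add: q_def vc_time_def l f)
  have len: "length (fair_vc x) \<le> length x" if "vc_output x (fair_vc x)" for x
    using that by (auto simp: vc_output_def Let_def)
  show ?thesis
    unfolding polynomial_time_def
  proof (intro exI[of _ fair_vc_prog] exI[of _ q] allI)
    fix x
    obtain t s where "exec fair_vc_prog (input_state x) t s" "t \<le> vc_time (length x)"
        "output_bits s = fair_vc x" "vc_output x (fair_vc x)"
      by (rule fair_vc_exec)
    then show "\<exists>t s. exec fair_vc_prog (input_state x) t s \<and>
        t + length (fair_vc x) \<le> poly q (length x) \<and> output_bits s = fair_vc x"
      using len[of x] q by (metis add_mono)
  qed
qed

theorem theorem5:
  "\<exists>f. polynomial_time f \<and>
     (\<forall>n E. simple_graph {..<n} E \<longrightarrow>
        (let V = {..<n}; k = opt_sparseness V E in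
         \<exists>W. f (encode_graph n E) = encode_set n W \<and>
             vertex_cover V E W \<and>
             (k > 0 \<longrightarrow>
                real (sparseness V E W) \<le> (2 - 1 / real k) * real k \<and>
                (2 - 1 / real k) * real k = 2 * real k - 1) \<and>
             (k = 0 \<longrightarrow> sparseness V E W = 0)))"
proof (intro exI[of _ fair_vc] conjI polynomial_time_fair_vc allI impI)
  fix n and E :: "nat set set"
  assume G: "simple_graph {..<n} E"
  let ?k = "opt_sparseness {..<n} E"
  have "vc_output (encode_graph n E) (fair_vc (encode_graph n E))"
    using fair_vc_exec by blast
  from vc_output_encode_graph[OF G this] obtain W where
    W: "fair_vc (encode_graph n E) = encode_set n W" "vertex_cover {..<n} E W"
      "?k > 0 \<longrightarrow> sparseness {..<n} E W \<le> 2 * ?k - 1" "?k = 0 \<longrightarrow> sparseness {..<n} E W = 0"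
    by (elim exE conjE) (rule that)
  have eq: "(2 - 1 / real ?k) * real ?k = 2 * real ?k - 1" if "?k > 0"
    using that by (simp add: left_diff_distrib)
  have le: "real (sparseness {..<n} E W) \<le> (2 - 1 / real ?k) * real ?k" if "?k > 0"
  proof -
    \<comment> \<open>The 1 is moved to the left before passing to the reals, so that no truncated
      subtraction has to be converted.\<close>
    have "sparseness {..<n} E W + 1 \<le> 2 * ?k" using W(3) that by linarith
    then have "real (sparseness {..<n} E W + 1) \<le> real (2 * ?k)" by (rule of_nat_mono)
    then show ?thesis unfolding eq[OF that] by simp
  qed
  show "let V = {..<n}; k = opt_sparseness V E in
      \<exists>W. fair_vc (encode_graph n E) = encode_set n W \<and> vertex_cover V E W \<and>
        (k > 0 \<longrightarrow> real (sparseness V E W) \<le> (2 - 1 / real k) * real k \<and>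
           (2 - 1 / real k) * real k = 2 * real k - 1) \<and>
        (k = 0 \<longrightarrow> sparseness V E W = 0)"
    unfolding Let_def by (intro exI[of _ W] conjI impI W(1,2) W(3,4)[rule_format] eq le)
qed

end
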